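(* Let $d\in\mathbb{R}^n$ and $G=A-\operatorname{Diag}(d)$. The facially reduced semidefinite program $$\begin{array}{rl}\min&\frac12\operatorname{trace}\widehat V^TL_G\widehat VZ\\ \text{s.t.}&\operatorname{arrow}(\widehat VZ\widehat V^T)=e_0,\quad \mathcal{G}_J(\widehat VZ\widehat V^T)=0,\quad(\widehat VZ\widehat V^T)_{00}=1,\\ &\mathcal{D}_O(\widehat VZ\widehat V^T)=M,\quad\mathcal{D}_e(\widehat VZ\widehat V^T)=e,\\ &Z\succeq0,\ Z\in\mathcal{S}^{(k-1)(n-1)+1}\end{array}$$ is equivalent (same feasible set and same objective) to the problem with a single equality constraint $$(\mathrm{SDP}_{final})\qquad\begin{array}{rl}\operatorname{cut}(m)\ge p^*_{SDP}(G)=\min&\frac12\operatorname{trace}\bigl(\widehat V^TL_G\widehat V\bigr)Z\\ \text{s.t.}&\mathcal{G}_{\bar J}(\widehat VZ\widehat V^T)=\mathcal{G}_{\bar J}(e_0e_0^T),\\ &Z\succeq0,\ Z\in\mathcal{S}^{(k-1)(n-1)+1}.\end{array}$$ The dual program of $(\mathrm{SDP}_{final})$ is $$\max_{W\in\mathcal{S}^{kn+1}}\ \tfrac12W_{00}\quad\text{s.t.}\quad\widehat V^T\mathcal{G}_{\bar J}(W)\widehat V\preceq\widehat V^TL_G\widehat V .$$ Both primal and dual satisfy Slater's constraint qualification: there is a feasible $Z\succ0$ for $(\mathrm{SDP}_{final})$, and there is $W\in\mathcal{S}^{kn+1}$ with $\widehat V^T\mathcal{G}_{\bar J}(W)\widehat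 V\prec\widehat V^TL_G\widehat V$. Moreover, the objective function of $(\mathrm{SDP}_{final})$ is independent, on the feasible set, of the vector $d\in\mathbb{R}^n$ chosen to form $G$.
   Context: Setting: an undirected (simple) graph with node set $N=\{1,\dots,n\}$, nonempty edge set and adjacency matrix $A$; $e$ (or $e_j\in\mathbb{R}^j$) is the all-ones vector, $\operatorname{Diag}(v)$ is the diagonal matrix with diagonal $v$, $\operatorname{diag}(Y)$ the diagonal of $Y$, $\otimes$ the Kronecker product, $\mathcal{S}^t$ the space of real symmetric $t\times t$ matrices, $\preceq,\prec$ the Loewner order. $k>2$ is an integer and $m=(m_1,\dots,m_k)^T$ is a vector of positive integers with $m_1+\dots+m_k=n$; $M=\operatorname{Diag}(m)$. $B=\begin{bmatrix} ee^T-I_{k-1} & 0\\ 0&0\end{bmatrix}\in\mathcal{S}^k$. $\operatorname{cut}(m)$ is the minimum, over all ordered partitions $(S_1,\dots,S_k)$ of $N$ with $|S_i|=m_i$, of the number of edges whose endpoints lie in two distinct sets among $S_1,\dots,S_{k-1}$. Rows and columns of $Y\in\mathcal{S}^{kn+1}$ are indexed $0,1,\dots,kn$; $e_0$ here is the $0$-th unit vector. Write $Y=\begin{bmatrix} Y_{00} & Y_{0,:} \\ Y_{:,0} & \bar Y \end{bmatrix}$, where $\bar Y$ is partitioned into $k^2$ blocks $\bar Y_{(ij)}\in\mathbb{R}^{n\times n}$, $i,j=1,\dots,k$. Define: - $L_G=\begin{bmatrix} 0 & 0 \\ 0 & B\otimes G \end{bmatrix}\in\mathcal{S}^{kn+1}$.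 - $\operatorname{arrow}(Y)=\operatorname{diag}(Y)-(0,Y_{0,1:kn})^T$. - $J=\{(i,j): i=(p-1)n+q,\ j=(r-1)n+q,\ p<r,\ p,r\in\{1,\dots,k\},\ q\in\{1,\dots,n\}\}$ and $\bar J=J\cup\{(0,0)\}$. For $K=J$ or $\bar J$, the gangster operator is $(\mathcal{G}_K(Y))_{ij}=Y_{ij}$ if $(i,j)\in K$ or $(j,i)\in K$, and $0$ otherwise. - $\mathcal{D}_O(Y)=(\operatorname{trace}\bar Y_{(ij)})_{i,j}\in\mathcal{S}^k$, and $\mathcal{D}_e(Y)=\sum_{i=1}^k\operatorname{diag}\bar Y_{(ii)}\in\mathbb{R}^n$. - $D_1=\begin{bmatrix} n & -e_k^T\otimes e_n^T \\ -e_k\otimes e_n & (e_ke_k^T)\otimes I_n \end{bmatrix}$ and $D_2=\begin{bmatrix} m^Tm & -m^T\otimes e_n^T \\ -m\otimes e_n & I_k\otimes(e_ne_n^T) \end{bmatrix}$. - $V_j\in\mathbb{R}^{j\times(j-1)}$ is a matrix of full column rank with $V_j^Te=0$, e.g. $V_j=\begin{bmatrix} I_{j-1} \\ -e_{j-1}^T \end{bmatrix}$, and $\widehat V=\begin{bmatrix} 1 & 0 \\ \frac1n m\otimes e_n & V_k\otimes V_n \end{bmatrix}$. $p^*_{SDP}(G)$ denotes the optimal value of the (not facially reduced) relaxation: minimize $\frac12\operatorname{trace}L_GY$ over $Y\in\mathcal{S}^{kn+1}$ subject to $\operatorname{arrow}(Y)=e_0$, $\operatorname{trace}D_1Y=0$,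 $\operatorname{trace}D_2Y=0$, $\mathcal{G}_J(Y)=0$, $\mathcal{D}_O(Y)=M$, $\mathcal{D}_e(Y)=e$, $Y_{00}=1$, $Y\succeq0$. The facially reduced program arises from it via the substitution $Y=\widehat VZ\widehat V^T$. *)

theory Defs
  imports "HOL-Analysis.Analysis"
begin

text \<open>
  The nodes form a finite type \<open>'n\<close> and the partition indices a finite linearly ordered
  type \<open>'k\<close>, so that n = CARD('n) and k = CARD('k).  The index set
  \<open>{0, 1, ..., kn}\<close> is \<open>('k \<times> 'n) option\<close>: \<open>None\<close> is the index 0 and
  \<open>Some (p, q)\<close> is the index (p - 1) n + q.
\<close>

definition sym_mat :: "real^'n^'n \<Rightarrow> bool" where
  "sym_mat A \<longleftrightarrow> transpose A = A"

definition psd :: "real^'n^'n \<Rightarrow> bool" where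
  "psd A \<longleftrightarrow> sym_mat A \<and> (\<forall>x. 0 \<le> x \<bullet> (A *v x))"

definition pd :: "real^'n^'n \<Rightarrow> bool" where
  "pd A \<longleftrightarrow> sym_mat A \<and> (\<forall>x. x \<noteq> 0 \<longrightarrow> 0 < x \<bullet> (A *v x))"

definition loewner_le :: "real^'n^'n \<Rightarrow> real^'n^'n \<Rightarrow> bool"  (infix \<open>\<preceq>\<^sub>L\<close> 50) where
  "A \<preceq>\<^sub>L B \<longleftrightarrow> psd (B - A)"

definition loewner_less :: "real^'n^'n \<Rightarrow> real^'n^'n \<Rightarrow> bool"  (infix \<open>\<prec>\<^sub>L\<close> 50) where
  "A \<prec>\<^sub>L B \<longleftrightarrow> pd (B - A)"

definition Diag :: "real^'n \<Rightarrow> real^'n^'n" where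
  "Diag v = (\<chi> i j. if i = j then v $ i else 0)"

definition diag :: "real^'n^'n \<Rightarrow> real^'n" where
  "diag A = (\<chi> i. A $ i $ i)"

definition outer :: "real^'m \<Rightarrow> real^'n \<Rightarrow> real^'n^'m" where
  "outer u v = (\<chi> i j. u $ i * v $ j)"

definition ones :: "real^'n" where
  "ones = (\<chi> i. 1)"

definition kron :: "real^'b::finite^'a::finite \<Rightarrow> real^'d::finite^'c::finite \<Rightarrow> real^('b \<times> 'd)^('a \<times> 'c)" where
  "kron A B = (\<chi> i j. A $ fst i $ fst j * B $ snd i $ snd j)"

definition kronv :: "real^'a::finite \<Rightarrow> real^'b::finite \<Rightarrow> real^('a \<times> 'b)" where
  "kronv u v = (\<chi> i. u $ fst i * v $ snd i)"

text \<open>\<open>bordered a u v C\<close> is the block matrix with first row \<open>(a, u\<^sup>T)\<close> and second row \<open>(v, C)\<close>.\<close>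

definition bordered ::
    "real \<Rightarrow> real^'c::finite \<Rightarrow> real^'r::finite \<Rightarrow> real^'c^'r \<Rightarrow> real^('c option)^('r option)" where
  "bordered a u v C = (\<chi> i j. case i of
       None \<Rightarrow> (case j of None \<Rightarrow> a | Some t \<Rightarrow> u $ t)
     | Some s \<Rightarrow> (case j of None \<Rightarrow> v $ s | Some t \<Rightarrow> C $ s $ t))"

definition e0 :: "real^('a::finite option)" where
  "e0 = axis None 1"

definition block :: "real^(('k::finite \<times> 'n::finite) option)^(('k \<times> 'n) option) \<Rightarrow> 'k \<Rightarrow> 'k \<Rightarrow> real^'n^'n" where
  "block Y i j = (\<chi> s t. Y $ Some (i, s) $ Some (j, t))"

definition simple_graph :: "'n set set \<Rightarrow> bool" where
  "simple_graph E \<longleftrightarrow> (\<forall>e\<in>E. card e = 2)"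

definition adjacency :: "'n set set \<Rightarrow> real^'n^'n" where
  "adjacency E = (\<chi> i j. if {i, j} \<in> E then 1 else 0)"

definition mvec :: "nat^'k \<Rightarrow> real^'k" where
  "mvec m = (\<chi> i. real (m $ i))"

definition last_index :: "'k::{finite,linorder}" where
  "last_index = Max UNIV"

definition Bmat :: "real^'k::{finite,linorder}^'k::{finite,linorder}" where
  "Bmat = (\<chi> i j. if i \<noteq> last_index \<and> j \<noteq> last_index \<and> i \<noteq> j then 1 else 0)"

definition ordered_partition :: "nat^'k \<Rightarrow> ('k \<Rightarrow> 'n::finite set) \<Rightarrow> bool" where
  "ordered_partition m S \<longleftrightarrow>
     (\<Union>i. S i) = UNIV \<and> (\<forall>i j. i \<noteq> j \<longrightarrow> S i \<inter> S j = {}) \<and> (\<forall>i. card (S i) = m $ i)"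

definition cut_edges :: "'n set set \<Rightarrow> ('k::{finite,linorder} \<Rightarrow> 'n set) \<Rightarrow> 'n set set" where
  "cut_edges E S = {e \<in> E. \<exists>p r u v. p \<noteq> r \<and> p \<noteq> last_index \<and> r \<noteq> last_index
     \<and> u \<in> S p \<and> v \<in> S r \<and> e = {u, v}}"

definition min_cut :: "'n::finite set set \<Rightarrow> nat^'k::{finite,linorder} \<Rightarrow> nat" where
  "min_cut E m = Min ((\<lambda>S. card (cut_edges E S)) ` {S. ordered_partition m S})"

definition LG :: "real^'n::finite^'n \<Rightarrow> real^(('k::{finite,linorder} \<times> 'n) option)^(('k \<times> 'n) option)" where
  "LG G = bordered 0 0 0 (kron Bmat G)"

definition arrow :: "real^('a::finite option)^('a option) \<Rightarrow> real^('a option)" where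
  "arrow Y = diag Y - (\<chi> i. case i of None \<Rightarrow> 0 | Some a \<Rightarrow> Y $ None $ Some a)"

definition J :: "(('k::linorder \<times> 'n) option \<times> ('k \<times> 'n) option) set" where
  "J = {(Some (p, q), Some (r, q)) | p r q. p < r}"

definition Jbar :: "(('k::linorder \<times> 'n) option \<times> ('k \<times> 'n) option) set" where
  "Jbar = J \<union> {(None, None)}"

definition gangster :: "('a \<times> 'a) set \<Rightarrow> real^'a^'a \<Rightarrow> real^'a^'a" where
  "gangster K Y = (\<chi> i j. if (i, j) \<in> K \<or> (j, i) \<in> K then Y $ i $ j else 0)"

definition DO :: "real^(('k::finite \<times> 'n::finite) option)^(('k \<times> 'n) option) \<Rightarrow> real^'k^'k" where
  "DO Y = (\<chi> i j. trace (block Y i j))"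

definition De :: "real^(('k::finite \<times> 'n::finite) option)^(('k \<times> 'n) option) \<Rightarrow> real^'n" where
  "De Y = (\<Sum>i\<in>UNIV. diag (block Y i i))"

definition D1 :: "real^(('k::finite \<times> 'n::finite) option)^(('k \<times> 'n) option)" where
  "D1 = bordered (real CARD('n)) (- kronv ones ones) (- kronv ones ones)
          (kron (outer ones ones) (mat 1))"

definition D2 :: "nat^'k::finite \<Rightarrow> real^(('k \<times> 'n::finite) option)^(('k \<times> 'n) option)" where
  "D2 m = bordered (mvec m \<bullet> mvec m) (- kronv (mvec m) ones) (- kronv (mvec m) ones)
            (kron (mat 1) (outer ones ones))"

text \<open>
  The types \<open>'k1\<close> and \<open>'n1\<close> index the columns of \<open>V\<^sub>k\<close> and \<open>V\<^sub>n\<close>; their cardinalities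
  are one less than those of \<open>'k\<close> and \<open>'n\<close>.
\<close>

definition is_V :: "real^'j1^'j \<Rightarrow> bool" where
  "is_V V \<longleftrightarrow> CARD('j) = CARD('j1) + 1 \<and> rank V = CARD('j1) \<and> transpose V *v ones = 0"

definition Vhat :: "nat^'k::finite \<Rightarrow> real^'k1::finite^'k \<Rightarrow> real^'n1::finite^'n::finite
    \<Rightarrow> real^(('k1 \<times> 'n1) option)^(('k \<times> 'n) option)" where
  "Vhat m Vk Vn = bordered 1 0 ((1 / real CARD('n)) *\<^sub>R kronv (mvec m) ones) (kron Vk Vn)"

definition lift :: "real^'b^'a \<Rightarrow> real^'b^'b \<Rightarrow> real^'a^'a" where
  "lift V Z = V ** Z ** transpose V"

definition reduce :: "real^'b^'a \<Rightarrow> real^'a^'a \<Rightarrow> real^'b^'b" where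
  "reduce V Y = transpose V ** Y ** V"

definition feasible_SDP ::
    "nat^'k::{finite,linorder} \<Rightarrow> real^(('k \<times> 'n::finite) option)^(('k \<times> 'n) option) \<Rightarrow> bool" where
  "feasible_SDP m Y \<longleftrightarrow>
     arrow Y = e0 \<and> trace (D1 ** Y) = 0 \<and> trace (D2 m ** Y) = 0 \<and> gangster J Y = 0
     \<and> DO Y = Diag (mvec m) \<and> De Y = ones \<and> Y $ None $ None = 1 \<and> psd Y"

definition p_SDP :: "real^'n::finite^'n \<Rightarrow> nat^'k::{finite,linorder} \<Rightarrow> ereal" where
  "p_SDP G m = (INF Y \<in> {Y :: real^(('k \<times> 'n) option)^(('k \<times> 'n) option). feasible_SDP m Y}.
     ereal (1 / 2 * trace (LG G ** Y)))"

definition feasible_reduced :: "nat^'k::{finite,linorder} \<Rightarrow> real^'k1::finite^'k::{finite,linorder} \<Rightarrow> real^'n1::finite^'n::finite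
    \<Rightarrow> real^(('k1 \<times> 'n1) option)^(('k1 \<times> 'n1) option) \<Rightarrow> bool" where
  "feasible_reduced m Vk Vn Z \<longleftrightarrow>
     (let Y = lift (Vhat m Vk Vn) Z in
       arrow Y = e0 \<and> gangster J Y = 0 \<and> Y $ None $ None = 1
       \<and> DO Y = Diag (mvec m) \<and> De Y = ones) \<and> psd Z"

definition obj_reduced :: "real^'n::finite^'n \<Rightarrow> nat^'k::{finite,linorder} \<Rightarrow> real^'k1::finite^'k::{finite,linorder} \<Rightarrow> real^'n1::finite^'n::finite
    \<Rightarrow> real^(('k1 \<times> 'n1) option)^(('k1 \<times> 'n1) option) \<Rightarrow> real" where
  "obj_reduced G m Vk Vn Z =
     1 / 2 * trace (transpose (Vhat m Vk Vn) ** LG G ** Vhat m Vk Vn ** Z)"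

definition feasible_final :: "nat^'k::{finite,linorder} \<Rightarrow> real^'k1::finite^'k::{finite,linorder} \<Rightarrow> real^'n1::finite^'n::finite
    \<Rightarrow> real^(('k1 \<times> 'n1) option)^(('k1 \<times> 'n1) option) \<Rightarrow> bool" where
  "feasible_final m Vk Vn Z \<longleftrightarrow>
     gangster Jbar (lift (Vhat m Vk Vn) Z) = gangster Jbar (outer e0 e0) \<and> psd Z"

definition obj_final :: "real^'n::finite^'n \<Rightarrow> nat^'k::{finite,linorder} \<Rightarrow> real^'k1::finite^'k::{finite,linorder} \<Rightarrow> real^'n1::finite^'n::finite
    \<Rightarrow> real^(('k1 \<times> 'n1) option)^(('k1 \<times> 'n1) option) \<Rightarrow> real" where
  "obj_final G m Vk Vn Z = 1 / 2 * trace (reduce (Vhat m Vk Vn) (LG G) ** Z)"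

text \<open>
  The Lagrangian dual function of the conic program: minimize \<open>f Z\<close> subject to
  \<open>\<A> Z = b\<close> and \<open>Z\<close> positive semidefinite.  The inner product of \<open>real^'a^'a\<close> is the
  trace inner product, so on symmetric matrices \<open>U \<bullet> X = trace (U ** X)\<close>.
\<close>

definition lagrange_dual ::
    "(real^'b^'b \<Rightarrow> real) \<Rightarrow> (real^'b^'b \<Rightarrow> real^'a^'a) \<Rightarrow> real^'a^'a \<Rightarrow> real^'a^'a \<Rightarrow> ereal" where
  "lagrange_dual f \<A> b U = (INF Z \<in> {Z. psd Z}. ereal (f Z + U \<bullet> (b - \<A> Z)))"

definition dual_final :: "real^'n::finite^'n \<Rightarrow> nat^'k::{finite,linorder} \<Rightarrow> real^'k1::finite^'k::{finite,linorder} \<Rightarrow> real^'n1::finite^'n::finite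
    \<Rightarrow> real^(('k \<times> 'n) option)^(('k \<times> 'n) option) \<Rightarrow> ereal" where
  "dual_final G m Vk Vn =
     lagrange_dual (obj_final G m Vk Vn) (\<lambda>Z. gangster Jbar (lift (Vhat m Vk Vn) Z))
       (gangster Jbar (outer e0 e0))"

definition feasible_dual :: "real^'n::finite^'n \<Rightarrow> nat^'k::{finite,linorder} \<Rightarrow> real^'k1::finite^'k::{finite,linorder} \<Rightarrow> real^'n1::finite^'n::finite
    \<Rightarrow> real^(('k \<times> 'n) option)^(('k \<times> 'n) option) \<Rightarrow> bool" where
  "feasible_dual G m Vk Vn W \<longleftrightarrow>
     sym_mat W \<and> reduce (Vhat m Vk Vn) (gangster Jbar W) \<preceq>\<^sub>L reduce (Vhat m Vk Vn) (LG G)"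

definition obj_dual :: "real^('a::finite option)^('a option) \<Rightarrow> real" where
  "obj_dual W = 1 / 2 * W $ None $ None"

end

theory Submission
  imports Defs
begin

text \<open>
  An ordered partition is a vector \<open>y\<close> with \<open>y\<^sub>0 = 1\<close> and 0/1 entries \<open>y\<^sub>p\<^sub>q\<close>, saying whether node
  \<open>q\<close> lies in the \<open>p\<close>-th set.  Such vectors satisfy the homogeneous linear equations
  \<open>\<Sum>\<^sub>p y\<^sub>p\<^sub>q = y\<^sub>0\<close> and \<open>\<Sum>\<^sub>q y\<^sub>p\<^sub>q = m\<^sub>p y\<^sub>0\<close>, called \<open>consistent\<close> below, and everything rests on one fact:
  the columns of \<open>Vhat\<close> are a basis of the space of consistent vectors
  (\<open>consistent_Vhat\<close>, \<open>Vhat_left_inverse\<close>).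

  \<^item> \<^emph>\<open>Redundant constraints.\<close>  The rows of \<open>Y = lift Vhat Z\<close> are consistent.  When the gangster
    constraint removes all entries with the same node and different sets, the first equation for the row
    \<open>(p, q)\<close> collapses to \<open>Y\<^sub>p\<^sub>q\<^sub>,\<^sub>p\<^sub>q = Y\<^sub>p\<^sub>q\<^sub>,\<^sub>0\<close>, which is the arrow constraint; the trace constraints
    are then the two equations for the row \<open>0\<close> (\<open>final_constraints\<close>).

  \<^item> \<^emph>\<open>Facial reduction.\<close>  \<open>D1\<close> and \<open>D2\<close> are sums of squares of the normals of the consistent space, so
    for \<open>Y\<close> positive semidefinite the equations \<open>trace D\<^sub>i Y = 0\<close> say exactly that the range of \<open>Y\<close>
    is consistent, and then \<open>Y\<close> factors through \<open>Vhat\<close> (\<open>feasible_SDP_iff\<close>).  The arrow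
    constraint bounds all entries of \<open>Y\<close> by 1, hence the optimum is attained.

  \<^item> \<^emph>\<open>Primal Slater point.\<close>  The mean of \<open>y y\<^sup>T\<close> over all partitions is known in closed form.  Its
    covariance part is a Kronecker product whose quadratic form is an explicit sum of squares vanishing only
    on arrays \<open>a\<^sub>p + b\<^sub>q\<close>, and those are annihilated by \<open>V\<^sub>k \<otimes> V\<^sub>n\<close> (\<open>primal_slater\<close>).

  \<^item> \<^emph>\<open>Dual Slater point.\<close>  A multiplier that is constant on \<open>J\<close>, with a suitable entry at \<open>(0, 0)\<close>, has
    on consistent vectors the quadratic form of a multiple of the identity, which dominates \<open>LG\<close> when the multiple is large (\<open>dual_slater\<close>).

  \<^item> \<^emph>\<open>Dual value and attainment.\<close>  The Lagrangian is affine in \<open>Z\<close>, so its infimum over the cone is finite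
    exactly when the slack matrix is positive semidefinite, by self-duality of the cone
    (\<open>psd_inner_nonneg\<close>).  In terms of the slack \<open>S\<close> the dual minimizes \<open>S \<bullet> Z\<close> for the primal Slater
    point \<open>Z\<close>, and the sublevel sets of this functional in the cone are compact (\<open>conic_dual_attained\<close>).

  \<^item> \<^emph>\<open>Cut and diagonal shift.\<close>  For a partition the objective at \<open>y y\<^sup>T\<close> counts the cut edges.
    A diagonal term of \<open>G\<close> meets only entries that the gangster constraint sets to zero.
\<close>

section \<open>Quadratic forms and the trace inner product\<close>

lemma quadform_transpose:
  fixes A :: "real^'n^'m"
  shows "x \<bullet> (A *v y) = (transpose A *v x) \<bullet> y"
  by (simp add: dot_lmul_matrix)

lemma sym_mat_nth: "sym_mat A \<longleftrightarrow> (\<forall>i j. A $ i $ j = A $ j $ i)"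
  by (auto simp: sym_mat_def transpose_def vec_eq_iff)

lemma quadform_sum:
  "x \<bullet> (A *v y) = (\<Sum>i\<in>UNIV. \<Sum>j\<in>UNIV. A $ i $ j * (x $ i * y $ j))"
  for A :: "real^'n^'m"
  by (simp add: inner_vec_def matrix_vector_mult_def sum_distrib_left mult_ac)

lemma sym_quadform_commute: "sym_mat A \<Longrightarrow> x \<bullet> (A *v y) = y \<bullet> (A *v x)"
  for A :: "real^'n^'n"
  by (metis quadform_transpose sym_mat_def inner_commute)

lemma axis_quadform: "axis i 1 \<bullet> (A *v axis j 1) = A $ i $ j"
  for A :: "real^'n^'m"
  by (simp add: matrix_vector_mul_component inner_axis' inner_axis column_def matrix_vector_mult_basis)

lemma outer_mult: "outer u v *v x = (v \<bullet> x) *\<^sub>R u"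
  by (simp add: outer_def matrix_vector_mult_def vec_eq_iff inner_vec_def sum_distrib_left mult_ac)

lemma inner_outer: "S \<bullet> outer u v = u \<bullet> (S *v v)"
  unfolding quadform_sum by (simp add: inner_vec_def outer_def)

lemma trace_mult_inner: "trace (A ** B) = A \<bullet> transpose B"
  for A :: "real^'n^'m"
  by (simp add: trace_def inner_vec_def matrix_matrix_mult_def transpose_def)

text \<open>
  The compression of a constraint matrix and the lifting of a variable are adjoint; together with
  \<open>gangster_selfadjoint\<close> this is the passage between the primal and the dual constraint.
\<close>

lemma reduce_adjoint: "reduce V Y \<bullet> Z = Y \<bullet> lift V Z"
proof -
  have "reduce V Y \<bullet> Z = trace (transpose V ** (Y ** V ** transpose Z))"
    by (simp add: reduce_def trace_mult_inner[of _ "transpose Z", symmetric, unfolded transpose_transpose] matrix_mul_assoc)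
  also have "\<dots> = trace (Y ** (V ** transpose Z ** transpose V))"
    by (subst trace_mul_sym) (simp add: matrix_mul_assoc)
  also have "\<dots> = Y \<bullet> lift V Z"
    by (subst trace_mult_inner) (simp add: lift_def matrix_transpose_mul matrix_mul_assoc)
  finally show ?thesis .
qed

lemma quadform_lift: "x \<bullet> (lift V Z *v y) = (transpose V *v x) \<bullet> (Z *v (transpose V *v y))"
  by (simp only: lift_def matrix_vector_mul_assoc[symmetric]
      quadform_transpose[of _ V])

lemma transpose_lift: "transpose (lift V Z) = lift V (transpose Z)"
  by (simp add: lift_def matrix_transpose_mul matrix_mul_assoc)

lemma sym_mat_lift: "sym_mat Z \<Longrightarrow> sym_mat (lift V Z)"
  by (simp add: sym_mat_def transpose_lift)

lemma psd_lift: "psd Z \<Longrightarrow> psd (lift V Z)"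
  by (auto simp: psd_def sym_mat_lift quadform_lift)

lemma lift_lift: "lift V (lift L Y) = lift (V ** L) Y"
  by (simp add: lift_def matrix_transpose_mul matrix_mul_assoc)

lemma lift_nth: "lift V Z $ i $ j = (\<Sum>k\<in>UNIV. \<Sum>l\<in>UNIV. V $ i $ k * Z $ k $ l * V $ j $ l)"
  by (simp add: lift_def matrix_matrix_mult_def transpose_def sum_distrib_right) (rule sum.swap)

lemma linear_lift: "linear (lift V)"
  by (rule linearI)
     (simp_all add: vec_eq_iff lift_nth distrib_left distrib_right sum.distrib sum_distrib_left mult_ac)

lemma reduce_eq_lift: "reduce V = lift (transpose V)"
  by (simp add: fun_eq_iff reduce_def lift_def)

lemma quadform_reduce: "x \<bullet> (reduce V Y *v y) = (V *v x) \<bullet> (Y *v (V *v y))"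
  by (simp add: reduce_eq_lift quadform_lift del: transpose_matrix_vector)

lemma linear_gangster: "linear (gangster K)"
  by (rule linearI) (auto simp: gangster_def vec_eq_iff)

lemma gangster_selfadjoint: "W \<bullet> gangster K Y = gangster K W \<bullet> Y"
  by (simp add: gangster_def inner_vec_def, intro sum.cong refl) auto

lemma sym_mat_gangster: "sym_mat W \<Longrightarrow> sym_mat (gangster K W)"
  by (auto simp: gangster_def sym_mat_nth)

section \<open>The cone of positive semidefinite matrices\<close>

text \<open>
  If \<open>x\<^sup>TAx = 0\<close>, then \<open>x\<close> minimizes the quadratic form, so the gradient \<open>2 A x\<close> vanishes.  Concretely,
  the form would become negative along the direction \<open>- A x\<close>.
\<close>

lemma psd_null:
  assumes "psd A" "x \<bullet> (A *v x) = 0"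
  shows "A *v x = 0"
proof -
  define y where "y = A *v x"
  define b where "b = y \<bullet> (A *v y)"
  have b: "b \<ge> 0" using assms by (auto simp: b_def psd_def)
  define a where "a = y \<bullet> y"
  have q: "0 \<le> 2 * t * a + t\<^sup>2 * b" for t
  proof -
    have "0 \<le> (x + t *\<^sub>R y) \<bullet> (A *v (x + t *\<^sub>R y))" using assms by (auto simp: psd_def)
    also have "\<dots> = x \<bullet> (A *v x) + t * (x \<bullet> (A *v y)) + t * (y \<bullet> (A *v x)) + t\<^sup>2 * b"
      by (simp add: matrix_vector_right_distrib matrix_vector_mult_scaleR inner_add_left inner_add_right
          power2_eq_square b_def algebra_simps)
    also have "x \<bullet> (A *v y) = a"
      using assms(1) sym_quadform_commute[of A x y] by (simp add: psd_def a_def flip: y_def)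
    finally show ?thesis using assms(2) by (simp add: a_def y_def)
  qed
  have "a = 0"
  proof (rule ccontr)
    assume "a \<noteq> 0"
    then have a: "a > 0" by (simp add: a_def)
    \<comment> \<open>Step length against the gradient; \<open>b + 1\<close> in place of the curvature \<open>b\<close> avoids a case distinction for \<open>b = 0\<close>.\<close>
    define r where "r = a / (b + 1)"
    have r: "a = r * (b + 1)" "r > 0" using a b by (auto simp: r_def)
    have "2 * (- r) * a + (- r)\<^sup>2 * b = - (r\<^sup>2 * (b + 2))"
      by (simp add: r(1) power2_eq_square algebra_simps)
    moreover have "r\<^sup>2 * (b + 2) > 0" using r b by (intro mult_pos_pos) auto
    ultimately show False using q[of "- r"] by linarith
  qed
  then show ?thesis by (simp add: a_def y_def)
qed

lemma psd_diag_nonneg: "psd A \<Longrightarrow> 0 \<le> A $ i $ i"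
  by (metis axis_quadform psd_def)

text \<open>
  Evaluate the form at \<open>e\<^sub>i + e\<^sub>j\<close> and \<open>e\<^sub>i - e\<^sub>j\<close>.  This arithmetic-mean version of the \<open>2 \<times> 2\<close> minor
  inequality suffices here and needs no square roots.
\<close>

lemma psd_entry_bound:
  assumes "psd A"
  shows "2 * \<bar>A $ i $ j\<bar> \<le> A $ i $ i + A $ j $ j"
proof -
  have s: "A $ i $ j = A $ j $ i" using assms by (simp add: psd_def sym_mat_nth)
  have "0 \<le> (axis i 1 + axis j 1) \<bullet> (A *v (axis i 1 + axis j 1))"
    "0 \<le> (axis i 1 - axis j 1) \<bullet> (A *v (axis i 1 - axis j 1))"
    using assms by (auto simp: psd_def)
  then show ?thesis
    using s by (simp add: matrix_vector_right_distrib matrix_vector_mult_diff_distrib inner_add_left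
        inner_add_right inner_diff_left inner_diff_right axis_quadform)
qed

lemma psd_outer: "psd (outer x x)"
proof -
  have "0 \<le> y \<bullet> (outer x x *v y)" for y
    by (simp add: outer_mult inner_commute)
  then show ?thesis by (simp add: psd_def sym_mat_nth outer_def mult.commute)
qed

lemma psd_scaleR: "psd A \<Longrightarrow> 0 \<le> t \<Longrightarrow> psd (t *\<^sub>R A)"
  by (simp add: psd_def sym_mat_nth scaleR_matrix_vector_assoc[symmetric])

text \<open>
  Self-duality of the cone.  The reason is that \<open>Z\<close> is a sum of matrices \<open>z z\<^sup>T\<close>, each contributing
  \<open>z\<^sup>TSz \<ge> 0\<close>.  Instead of a spectral decomposition the proof peels off one such term at a time: with a
  pivot \<open>c = Z\<^sub>i\<^sub>i > 0\<close> and the column \<open>z\<close> of the pivot, the Schur complement \<open>Z - z z\<^sup>T / c\<close> is again positive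
  semidefinite and has fewer nonzero diagonal entries.
\<close>

lemma psd_inner_nonneg:
  fixes S Z :: "real^'n^'n"
  assumes S: "psd S"
  shows "psd Z \<Longrightarrow> 0 \<le> S \<bullet> Z"
proof (induction "card {i. Z $ i $ i \<noteq> 0}" arbitrary: Z rule: less_induct)
  case less
  show ?case
  proof (cases "\<exists>i. Z $ i $ i \<noteq> 0")
    case False
    then have "Z = 0"
      using psd_entry_bound[OF less.prems] by (auto simp: vec_eq_iff)
    then show ?thesis by simp
  next
    case True
    then obtain i where i: "Z $ i $ i \<noteq> 0" by blast
    define c where "c = Z $ i $ i"
    have c: "c > 0" using i psd_diag_nonneg[OF less.prems, of i] by (simp add: c_def)
    define z where "z = Z *v axis i 1"
    have z: "z $ j = Z $ j $ i" for j
      by (simp add: z_def matrix_vector_mult_basis column_def)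
    define Z' where "Z' = Z - (1 / c) *\<^sub>R outer z z"
    have sym: "Z $ j $ k = Z $ k $ j" for j k using less.prems by (simp add: psd_def sym_mat_nth)
    have "0 \<le> x \<bullet> (Z' *v x)" for x
    proof -
      \<comment> \<open>Completing the square: \<open>t\<close> minimizes the form of \<open>Z\<close> along \<open>x - t e\<^sub>i\<close>.\<close>
      define t where "t = (z \<bullet> x) / c"
      define y where "y = x - t *\<^sub>R axis i 1"
      have zx: "x \<bullet> z = z \<bullet> x" "axis i 1 \<bullet> (Z *v x) = z \<bullet> x"
        using less.prems by (simp_all add: inner_commute psd_def z_def sym_quadform_commute[of Z _ x])
      have "0 \<le> y \<bullet> (Z *v y)" using less.prems by (simp add: psd_def)
      also have "\<dots> = x \<bullet> (Z *v x) - 2 * t * (z \<bullet> x) + t\<^sup>2 * c"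
        unfolding y_def
        by (simp add: matrix_vector_mult_diff_distrib matrix_vector_mult_scaleR inner_diff_left
          inner_diff_right axis_quadform zx z_def[symmetric] c_def[symmetric] power2_eq_square algebra_simps)
           (simp add: inner_axis' z c_def)
      also have "\<dots> = x \<bullet> (Z *v x) - (z \<bullet> x)\<^sup>2 / c"
        using c by (simp add: t_def power2_eq_square field_simps)
      also have "\<dots> = x \<bullet> (Z' *v x)"
        by (simp add: Z'_def matrix_vector_mult_diff_rdistrib scaleR_matrix_vector_assoc[symmetric]
            outer_mult inner_diff_right power2_eq_square inner_commute)
      finally show ?thesis .
    qed
    then have psd': "psd Z'"
      by (auto simp: psd_def sym_mat_nth Z'_def outer_def sym)
    have "Z' $ i $ i = 0" using c by (simp add: Z'_def outer_def z c_def)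
    \<comment> \<open>A zero diagonal entry has a zero row, so the peeling does not disturb it.\<close>
    moreover have "Z' $ j $ j = 0" if "Z $ j $ j = 0" for j
    proof -
      have "Z *v axis j 1 = 0"
        by (rule psd_null[OF less.prems]) (simp add: axis_quadform that)
      then have "Z $ i $ j = 0" by (metis axis_quadform inner_zero_right)
      then show ?thesis using that by (simp add: Z'_def outer_def z sym[of j i])
    qed
    ultimately have "{j. Z' $ j $ j \<noteq> 0} \<subset> {j. Z $ j $ j \<noteq> 0}" using i by blast
    then have "0 \<le> S \<bullet> Z'"
      by (intro less.hyps psd' psubset_card_mono) auto
    moreover have "S \<bullet> Z = S \<bullet> Z' + (z \<bullet> (S *v z)) / c"
      by (simp add: Z'_def inner_diff_right inner_outer)
    moreover have "0 \<le> (z \<bullet> (S *v z)) / c" using S c by (simp add: psd_def)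
    ultimately show ?thesis by simp
  qed
qed

lemma closed_psd: "closed {A :: real^'n^'n. psd A}"
proof -
  have "{A :: real^'n^'n. psd A} = {A. \<forall>i j. A $ i $ j = A $ j $ i} \<inter> {A. \<forall>x. 0 \<le> A \<bullet> outer x x}"
    by (auto simp: psd_def sym_mat_nth inner_outer)
  also have "closed \<dots>"
    by (intro closed_Int closed_Collect_all closed_Collect_eq closed_Collect_le continuous_intros)
  finally show ?thesis .
qed

lemma bounded_matrix_entries:
  fixes F :: "(real^'n^'m) set"
  assumes "\<And>A i j. A \<in> F \<Longrightarrow> \<bar>A $ i $ j\<bar> \<le> c"
  shows "bounded F"
proof (rule boundedI)
  fix A assume A: "A \<in> F"
  have "norm A \<le> (\<Sum>i\<in>UNIV. norm (A $ i))"
    unfolding norm_vec_def by (simp add: L2_set_le_sum)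
  also have "\<dots> \<le> (\<Sum>i\<in>UNIV. \<Sum>j\<in>UNIV. \<bar>A $ i $ j\<bar>)"
    by (intro sum_mono norm_le_l1_cart)
  also have "\<dots> \<le> (\<Sum>i\<in>(UNIV::'m set). \<Sum>j\<in>(UNIV::'n set). c)"
    by (intro sum_mono assms A)
  finally show "norm A \<le> (\<Sum>i\<in>(UNIV::'m set). \<Sum>j\<in>(UNIV::'n set). c)" .
qed

lemma pd_imp_psd: "pd A \<Longrightarrow> psd A"
  unfolding pd_def psd_def by (metis inner_zero_left less_imp_le order_refl)

text \<open>
  On the compact unit sphere the form attains a positive minimum \<open>\<delta>\<close>; the rest is homogeneity.
\<close>

lemma pd_coercive:
  fixes A :: "real^'n^'n"
  assumes "pd A"
  obtains \<delta> where "\<delta> > 0" "\<And>x. \<delta> * (x \<bullet> x) \<le> x \<bullet> (A *v x)"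
proof -
  have "compact (sphere (0::real^'n) 1)" "sphere (0::real^'n) 1 \<noteq> {}"
    by auto
  moreover have "continuous_on (sphere 0 1) (\<lambda>x. x \<bullet> (A *v x))"
    by (intro continuous_intros linear_continuous_on matrix_vector_mul_bounded_linear)
  ultimately obtain u where u: "u \<in> sphere 0 1"
    and min: "\<And>x. x \<in> sphere 0 1 \<Longrightarrow> u \<bullet> (A *v u) \<le> x \<bullet> (A *v x)"
    by (blast dest: continuous_attains_inf)
  show thesis
  proof
    have "u \<noteq> 0" using u by auto
    then show "u \<bullet> (A *v u) > 0" using assms by (simp add: pd_def)
    show "u \<bullet> (A *v u) * (x \<bullet> x) \<le> x \<bullet> (A *v x)" for x
    proof (cases "x = 0")
      case False
      have "u \<bullet> (A *v u) \<le> ((1 / norm x) *\<^sub>R x) \<bullet> (A *v ((1 / norm x) *\<^sub>R x))"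
        using False by (intro min) simp
      also have "\<dots> = (x \<bullet> (A *v x)) / (norm x)\<^sup>2"
        by (simp add: matrix_vector_mult_scaleR power2_eq_square)
      finally show ?thesis using False
        by (simp add: pos_le_divide_eq power2_norm_eq_inner)
    qed simp
  qed
qed

text \<open>
  Pair \<open>S\<close> with the positive semidefinite matrix \<open>A - \<delta> I\<close>.  For \<open>\<delta> > 0\<close> this makes the sets
  \<open>{S. psd S \<and> S \<bullet> A \<le> c}\<close> bounded, because the trace controls every entry of \<open>S\<close>.
\<close>

lemma psd_inner_bounds_trace:
  fixes S A :: "real^'n^'n"
  assumes S: "psd S" and A: "sym_mat A" "\<And>x. \<delta> * (x \<bullet> x) \<le> x \<bullet> (A *v x)"
  shows "\<delta> * trace S \<le> S \<bullet> A"
proof -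
  have "psd (A - \<delta> *\<^sub>R mat 1)"
    unfolding psd_def
  proof
    show "sym_mat (A - \<delta> *\<^sub>R mat 1)"
      using A(1) by (simp add: sym_mat_nth mat_def)
    show "\<forall>x. 0 \<le> x \<bullet> ((A - \<delta> *\<^sub>R mat 1) *v x)"
      using A(2) by (simp add: matrix_vector_mult_diff_rdistrib
        scaleR_matrix_vector_assoc[symmetric] inner_diff_right)
  qed
  then have "0 \<le> S \<bullet> (A - \<delta> *\<^sub>R mat 1)" by (rule psd_inner_nonneg[OF S])
  moreover have "S \<bullet> mat 1 = trace S"
    using trace_mult_inner[of S "mat 1"] by (simp add: transpose_mat)
  ultimately show ?thesis by (simp add: inner_diff_right)
qed

lemma psd_entry_le_trace:
  assumes "psd S"
  shows "\<bar>S $ i $ j\<bar> \<le> trace S"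
proof -
  have "S $ k $ k \<le> trace S" for k
    unfolding trace_def by (rule member_le_sum) (auto simp: psd_diag_nonneg assms)
  then show ?thesis using psd_entry_bound[OF assms, of i j] by (smt (verit))
qed

section \<open>Duality for the semidefinite cone\<close>

text \<open>
  Attainment in the dual under primal Slater.  The set of multipliers may be unbounded, for \<open>\<A>'\<close> need not
  be injective, so compactness is sought among the slacks \<open>S = C - \<A>' W\<close>: they range over an affine
  subspace, which is closed, and the dual objective is \<open>C \<bullet> Z - S \<bullet> Z\<close>.  Since \<open>Z\<close> is positive definite,
  the sublevel sets of \<open>S \<bullet> Z\<close> within the cone are compact.
\<close>

lemma conic_dual_attained:
  fixes C Z :: "real^'b^'b" and \<A>' :: "'w::real_vector \<Rightarrow> real^'b^'b"
  assumes lin: "linear \<A>'" and sub: "subspace X"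
    and Z: "pd Z" and obj: "\<And>W. W \<in> X \<Longrightarrow> b W = \<A>' W \<bullet> Z"
    and ne: "W0 \<in> X" "psd (C - \<A>' W0)"
  obtains W where "W \<in> X" "psd (C - \<A>' W)"
    "\<And>W'. W' \<in> X \<Longrightarrow> psd (C - \<A>' W') \<Longrightarrow> b W' \<le> b W"
proof -
  define S0 where "S0 = C - \<A>' W0"
  define K where "K = {S. psd S} \<inter> (\<lambda>T. C - T) ` \<A>' ` X \<inter> {S. S \<bullet> Z \<le> S0 \<bullet> Z}"
  have "closed ((\<lambda>T. C + T) ` uminus ` \<A>' ` X)"
    by (intro closed_translation closed_negations closed_subspace linear_subspace_image lin sub)
  then have "closed ((\<lambda>T. C - T) ` \<A>' ` X)"
    by (simp add: image_image)
  then have "closed K"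
    unfolding K_def by (intro closed_Int closed_psd closed_Collect_le continuous_intros) auto
  moreover obtain \<delta> where d: "\<delta> > 0" "\<And>x. \<delta> * (x \<bullet> x) \<le> x \<bullet> (Z *v x)"
    using pd_coercive[OF Z] by blast
  have "bounded K"
  proof (rule bounded_matrix_entries[of _ "(S0 \<bullet> Z) / \<delta>"])
    fix S i j assume S: "S \<in> K"
    then have "\<bar>S $ i $ j\<bar> \<le> trace S" by (intro psd_entry_le_trace) (simp add: K_def)
    moreover have "\<delta> * trace S \<le> S \<bullet> Z"
      by (rule psd_inner_bounds_trace) (use S Z d in \<open>auto simp: K_def pd_def\<close>)
    moreover have "S \<bullet> Z \<le> S0 \<bullet> Z" using S by (simp add: K_def)
    ultimately have "\<bar>S $ i $ j\<bar> \<le> trace S" "\<delta> * trace S \<le> S0 \<bullet> Z" by linarith+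
    then show "\<bar>S $ i $ j\<bar> \<le> (S0 \<bullet> Z) / \<delta>"
      using d(1) by (smt (verit) pos_le_divide_eq mult.commute)
  qed
  ultimately have "compact K" by (simp add: compact_eq_bounded_closed)
  moreover have S0: "S0 \<in> K" using ne by (auto simp: K_def S0_def)
  moreover have "continuous_on K (\<lambda>S. S \<bullet> Z)" by (intro continuous_intros)
  ultimately obtain S where S: "S \<in> K" and min: "\<And>T. T \<in> K \<Longrightarrow> S \<bullet> Z \<le> T \<bullet> Z"
    by (metis continuous_attains_inf empty_iff)
  then obtain W where W: "W \<in> X" "S = C - \<A>' W" by (auto simp: K_def)
  show thesis
  proof
    show "W \<in> X" "psd (C - \<A>' W)" using W S by (auto simp: K_def)
    fix W' assume W': "W' \<in> X" "psd (C - \<A>' W')"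
    have "S \<bullet> Z \<le> (C - \<A>' W') \<bullet> Z"
    proof (cases "(C - \<A>' W') \<bullet> Z \<le> S0 \<bullet> Z")
      case True
      then show ?thesis using W' by (intro min) (auto simp: K_def)
    next
      case False
      then show ?thesis using min[OF S0] by linarith
    qed
    then show "b W' \<le> b W"
      by (simp add: obj W W' inner_diff_left)
  qed
qed

text \<open>
  A linear functional is bounded below on a cone only if it is nonnegative there, and then its infimum is its
  value at 0.  A direction \<open>x\<close> with \<open>x\<^sup>TSx < 0\<close> drives the objective to \<open>-\<infinity>\<close> along the ray
  \<open>t x x\<^sup>T\<close>.
\<close>

lemma conic_lagrange_dual:
  fixes C S :: "real^'b^'b"
  assumes S: "sym_mat S" and f: "\<And>Z. psd Z \<Longrightarrow> f Z = w + (1/2) * (S \<bullet> Z)"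
  shows "(INF Z \<in> {Z. psd Z}. ereal (f Z)) = (if psd S then ereal w else - \<infinity>)"
proof (cases "psd S")
  case True
  have "(INF Z \<in> {Z. psd Z}. ereal (f Z)) = ereal w"
  proof (rule antisym)
    have "psd (0 :: real^'b^'b)" by (simp add: psd_def sym_mat_nth)
    then show "(INF Z \<in> {Z. psd Z}. ereal (f Z)) \<le> ereal w"
      using f[of 0] by (intro INF_lower2[of 0]) auto
    show "ereal w \<le> (INF Z \<in> {Z. psd Z}. ereal (f Z))"
      by (rule INF_greatest) (simp add: f psd_inner_nonneg[OF True])
  qed
  then show ?thesis using True by simp
next
  case False
  then obtain x where x: "x \<bullet> (S *v x) < 0" using S by (auto simp: psd_def not_le)
  have "(INF Z \<in> {Z. psd Z}. ereal (f Z)) \<le> ereal B" for B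
  proof -
    \<comment> \<open>Far enough along the ray for the objective to equal \<open>w - \<bar>B - w\<bar> \<le> B\<close>.\<close>
    define t where "t = 2 * \<bar>B - w\<bar> / (- (x \<bullet> (S *v x)))"
    have "t \<ge> 0" using x unfolding t_def by (intro divide_nonneg_pos) auto
    then have p: "psd (t *\<^sub>R outer x x)" by (intro psd_scaleR psd_outer)
    have "f (t *\<^sub>R outer x x) = w - \<bar>B - w\<bar>"
      unfolding f[OF p] using x by (simp add: inner_outer t_def)
    then show ?thesis using p by (intro INF_lower2[of "t *\<^sub>R outer x x"]) auto
  qed
  then have "(INF Z \<in> {Z. psd Z}. ereal (f Z)) = - \<infinity>"
    by (metis ereal_bot)
  then show ?thesis using False by simp
qed

section \<open>The columns of Vhat span the consistent vectors\<close>

lemma if_one_zero_mult: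
  fixes x :: real
  shows "(if c then 1 else 0) * x = (if c then x else 0)" "x * (if c then 1 else 0) = (if c then x else 0)"
  by simp_all

lemma sum_option_prod:
  fixes f :: "('k::finite \<times> 'n::finite) option \<Rightarrow> 'b::comm_monoid_add"
  shows "(\<Sum>i\<in>UNIV. f i) = f None + (\<Sum>p\<in>UNIV. \<Sum>q\<in>UNIV. f (Some (p, q)))"
proof -
  have "(\<Sum>i\<in>UNIV. f i) = f None + (\<Sum>i\<in>range Some. f i)"
    unfolding UNIV_option_conv by (subst sum.insert) auto
  also have "(\<Sum>i\<in>range Some. f i) = (\<Sum>a\<in>UNIV \<times> UNIV. f (Some a))"
    by (subst sum.reindex) auto
  also have "\<dots> = (\<Sum>p\<in>UNIV. \<Sum>q\<in>UNIV. f (Some (p, q)))"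
    by (subst sum.cartesian_product) (simp add: case_prod_unfold)
  finally show ?thesis .
qed

text \<open>
  The mixed-product rule \<open>(A \<otimes> B)(C \<otimes> D) = AC \<otimes> BD\<close>, applied to a vector \<open>y\<close> and written entrywise.
\<close>

lemma kron_sum_compose:
  fixes A :: "real^'a^'p" and C :: "real^'r^'a" and B :: "real^'b^'q" and D :: "real^'s^'b"
  shows "(\<Sum>a\<in>UNIV. \<Sum>b\<in>UNIV. A $ p $ a * B $ q $ b * (\<Sum>r\<in>UNIV. \<Sum>s\<in>UNIV. C $ a $ r * D $ b $ s * y r s))
       = (\<Sum>r\<in>UNIV. \<Sum>s\<in>UNIV. (A ** C) $ p $ r * (B ** D) $ q $ s * y r s)" (is "_ = ?R")
proof -
  have "?R = (\<Sum>r\<in>UNIV. \<Sum>s\<in>UNIV. \<Sum>a\<in>UNIV. \<Sum>b\<in>UNIV.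
      A $ p $ a * C $ a $ r * (B $ q $ b * D $ b $ s) * y r s)"
    unfolding matrix_matrix_mult_def by (simp add: sum_product) (simp add: sum_distrib_right)
  also have "\<dots> = (\<Sum>r\<in>UNIV. \<Sum>a\<in>UNIV. \<Sum>b\<in>UNIV. \<Sum>s\<in>UNIV.
      A $ p $ a * C $ a $ r * (B $ q $ b * D $ b $ s) * y r s)"
    by (intro sum.cong refl, subst sum.swap, intro sum.cong refl, rule sum.swap)
  also have "\<dots> = (\<Sum>a\<in>UNIV. \<Sum>b\<in>UNIV. \<Sum>r\<in>UNIV. \<Sum>s\<in>UNIV.
      A $ p $ a * C $ a $ r * (B $ q $ b * D $ b $ s) * y r s)"
    by (subst sum.swap, intro sum.cong refl, rule sum.swap)
  finally show ?thesis by (simp add: sum_distrib_left mult_ac)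
qed

text \<open>
  The range lies in the hyperplane orthogonal to the all-ones vector, and full column rank makes the
  dimensions agree.
\<close>

lemma range_is_V:
  fixes V :: "real^'j1^'j"
  assumes V: "is_V V"
  shows "range ((*v) V) = {x. ones \<bullet> x = 0}"
proof (rule subspace_dim_equal)
  show "subspace (range ((*v) V))"
    by (intro linear_subspace_image subspace_UNIV matrix_vector_mul_linear)
  show "subspace {x :: real^'j. ones \<bullet> x = 0}" by (rule subspace_hyperplane)
  show "range ((*v) V) \<subseteq> {x. ones \<bullet> x = 0}"
    using V by (auto simp: is_V_def quadform_transpose simp del: transpose_matrix_vector)
  have "(ones :: real^'j) \<noteq> 0" by (simp add: ones_def vec_eq_iff)
  then have "dim {x :: real^'j. ones \<bullet> x = 0} = CARD('j) - 1"
    using dim_hyperplane by force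
  then show "dim {x :: real^'j. ones \<bullet> x = 0} \<le> dim (range ((*v) V))"
    using V by (simp add: is_V_def rank_dim_range)
qed

text \<open>
  The pseudoinverse of \<open>V\<close>: the hyperplane orthogonal to \<open>ones\<close> is the range of \<open>V\<close>, so the columns of the orthogonal
  projection onto it have preimages, which are the columns of \<open>L\<close>.
\<close>

lemma is_V_left_inverse:
  fixes V :: "real^'j1^'j"
  assumes V: "is_V V"
  obtains L where "L ** V = mat 1" "V ** L = mat 1 - (1 / real CARD('j)) *\<^sub>R outer ones ones"
proof -
  define P :: "real^'j^'j" where "P = mat 1 - (1 / real CARD('j)) *\<^sub>R outer ones ones"
  have P: "P *v x = x - ((ones \<bullet> x) / real CARD('j)) *\<^sub>R ones" for x
    by (simp add: P_def matrix_vector_mult_diff_rdistrib scaleR_matrix_vector_assoc[symmetric] outer_mult)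
  have "ones \<bullet> (P *v x) = 0" for x
    by (simp add: P inner_diff_right) (simp add: ones_def inner_vec_def)
  then have "\<forall>j. \<exists>y. V *v y = P *v axis j 1"
    using range_is_V[OF V] by (metis (mono_tags, lifting) imageE mem_Collect_eq)
  then obtain l where l: "\<And>j. V *v l j = P *v axis j 1" by metis
  define L where "L = (\<chi> i j. l j $ i)"
  have VL: "V ** L = P"
  proof -
    have "column j L = l j" for j by (simp add: L_def column_def vec_eq_iff)
    then have "(V ** L) *v axis j 1 = P *v axis j 1" for j
      by (simp flip: matrix_vector_mul_assoc add: l matrix_vector_mult_basis[of L])
    then show ?thesis by (simp add: matrix_vector_mult_basis column_def vec_eq_iff)
  qed
  have "L ** V = mat 1"
  proof (rule matrix_eq[THEN iffD2], rule allI)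
    fix x
    have "V *v x \<in> range ((*v) V)" by simp
    then have "ones \<bullet> (V *v x) = 0" unfolding range_is_V[OF V] by simp
    then have "V *v (L *v (V *v x)) = V *v x"
      using P[of "V *v x"] by (metis VL matrix_vector_mul_assoc diff_zero div_0 scaleR_zero_left)
    moreover have "inj ((*v) V)" using V by (simp add: is_V_def full_rank_injective)
    ultimately show "(L ** V) *v x = mat 1 *v x"
      by (simp add: inj_eq flip: matrix_vector_mul_assoc)
  qed
  then show thesis using VL that unfolding P_def by blast
qed

text \<open>
  The homogenized assignment and size equations: with \<open>y $ None = 1\<close> they say that the array
  \<open>(y\<^sub>p\<^sub>q)\<close> has column sums 1 and row sums \<open>m\<^sub>p\<close>.
\<close>

definition consistent :: "nat^'k::finite \<Rightarrow> real^(('k \<times> 'n::finite) option) \<Rightarrow> bool" where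
  "consistent m y \<longleftrightarrow> (\<forall>q. (\<Sum>p\<in>UNIV. y $ Some (p, q)) = y $ None)
     \<and> (\<forall>p. (\<Sum>q\<in>UNIV. y $ Some (p, q)) = real (m $ p) * y $ None)"

lemma Vhat_None: "(Vhat m Vk Vn *v z) $ None = z $ None"
  by (simp add: Vhat_def bordered_def matrix_vector_mult_def sum_option_prod)

lemma Vhat_Some:
  fixes Vn :: "real^'n1::finite^'n::finite"
  shows "(Vhat m Vk Vn *v z) $ Some (p, q) = real (m $ p) / real CARD('n) * z $ None
     + (\<Sum>a\<in>UNIV. \<Sum>b\<in>UNIV. Vk $ p $ a * Vn $ q $ b * z $ Some (a, b))"
  by (simp add: Vhat_def bordered_def matrix_vector_mult_def sum_option_prod kron_def kronv_def
      mvec_def ones_def)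

lemma is_V_col_sum: "is_V V \<Longrightarrow> (\<Sum>p\<in>UNIV. V $ p $ a) = 0"
  by (auto simp: is_V_def ones_def vec_eq_iff vector_matrix_mult_def)

lemma consistent_Vhat:
  fixes Vn :: "real^'n1::finite^'n::finite" and Vk :: "real^'k1::finite^'k::finite"
  assumes m: "(\<Sum>i\<in>UNIV. m $ i) = CARD('n)" and V: "is_V Vk" "is_V Vn"
  shows "consistent m (Vhat m Vk Vn *v z)"
  unfolding consistent_def Vhat_None Vhat_Some
proof (intro conjI allI)
  have n: "(\<Sum>p\<in>UNIV. real (m $ p)) = real CARD('n)" using m by (metis of_nat_sum)
  fix q :: 'n
  have "(\<Sum>p\<in>UNIV. \<Sum>a\<in>UNIV. \<Sum>b\<in>UNIV. Vk $ p $ a * Vn $ q $ b * z $ Some (a, b))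
      = (\<Sum>a\<in>UNIV. \<Sum>b\<in>UNIV. (\<Sum>p\<in>UNIV. Vk $ p $ a) * Vn $ q $ b * z $ Some (a, b))"
    unfolding sum_distrib_right by (subst sum.swap, rule sum.cong[OF refl], subst sum.swap, rule refl)
  then show "(\<Sum>p\<in>UNIV. real (m $ p) / real CARD('n) * z $ None
     + (\<Sum>a\<in>UNIV. \<Sum>b\<in>UNIV. Vk $ p $ a * Vn $ q $ b * z $ Some (a, b))) = z $ None"
    by (simp add: sum.distrib is_V_col_sum V n flip: sum_distrib_right sum_divide_distrib)
next
  fix p :: 'k
  have "(\<Sum>q\<in>UNIV. \<Sum>a\<in>UNIV. \<Sum>b\<in>UNIV. Vk $ p $ a * Vn $ q $ b * z $ Some (a, b))
      = (\<Sum>a\<in>UNIV. \<Sum>b\<in>UNIV. Vk $ p $ a * (\<Sum>q\<in>UNIV. Vn $ q $ b) * z $ Some (a, b))"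
    unfolding sum_distrib_right sum_distrib_left
    by (subst sum.swap, rule sum.cong[OF refl], subst sum.swap, rule refl)
  then show "(\<Sum>q\<in>UNIV. real (m $ p) / real CARD('n) * z $ None
     + (\<Sum>a\<in>UNIV. \<Sum>b\<in>UNIV. Vk $ p $ a * Vn $ q $ b * z $ Some (a, b))) = real (m $ p) * z $ None"
    by (simp add: sum.distrib is_V_col_sum V)
qed

text \<open>
  The left inverse is \<open>1 \<oplus> (L\<^sub>k \<otimes> L\<^sub>n)\<close> for the pseudoinverses \<open>L\<^sub>k\<close>, \<open>L\<^sub>n\<close> of \<open>V\<^sub>k\<close>, \<open>V\<^sub>n\<close>.  It annihilates
  the offset \<open>m \<otimes> e / n\<close> in the first column of \<open>Vhat\<close>, because \<open>L\<^sub>n e = 0\<close>.  On a consistent \<open>y\<close> the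
  product of the two centring projections subtracts the row and column means and adds back the grand mean.  All of these are
  known multiples of \<open>y\<^sub>0\<close>, and together they amount to the offset.
\<close>

lemma Vhat_left_inverse:
  fixes Vn :: "real^'n1::finite^'n::finite" and Vk :: "real^'k1::finite^'k::finite"
  assumes V: "is_V Vk" "is_V Vn"
  obtains L where "L ** Vhat m Vk Vn = mat 1"
    "\<And>y. consistent m y \<Longrightarrow> Vhat m Vk Vn *v (L *v y) = y"
proof -
  obtain Lk where Lk: "Lk ** Vk = mat 1" "Vk ** Lk = mat 1 - (1 / real CARD('k)) *\<^sub>R outer ones ones"
    using is_V_left_inverse[OF V(1)] by blast
  obtain Ln where Ln: "Ln ** Vn = mat 1" "Vn ** Ln = mat 1 - (1 / real CARD('n)) *\<^sub>R outer ones ones"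
    using is_V_left_inverse[OF V(2)] by blast
  define L where "L = bordered 1 0 0 (kron Lk Ln)"
  have LNone: "(L *v y) $ None = y $ None" for y
    by (simp add: L_def bordered_def matrix_vector_mult_def sum_option_prod)
  have LSome: "(L *v y) $ Some (a, b) = (\<Sum>p\<in>UNIV. \<Sum>q\<in>UNIV. Lk $ a $ p * Ln $ b $ q * y $ Some (p, q))" for y a b
    by (simp add: L_def bordered_def matrix_vector_mult_def sum_option_prod kron_def)
  have VVL: "Vhat m Vk Vn *v (L *v y) = y" if y: "consistent m y" for y
  proof -
    have "(Vhat m Vk Vn *v (L *v y)) $ Some (p, q) = y $ Some (p, q)" for p q
    proof -
      have "(\<Sum>a\<in>UNIV. \<Sum>b\<in>UNIV. Vk $ p $ a * Vn $ q $ b * (L *v y) $ Some (a, b))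
        = (\<Sum>r\<in>UNIV. \<Sum>s\<in>UNIV. (Vk ** Lk) $ p $ r * (Vn ** Ln) $ q $ s * y $ Some (r, s))"
        unfolding LSome by (rule kron_sum_compose)
      also have "\<dots> = y $ Some (p, q) - (\<Sum>r\<in>UNIV. y $ Some (r, q)) / real CARD('k)
          - (\<Sum>s\<in>UNIV. y $ Some (p, s)) / real CARD('n)
          + (\<Sum>s\<in>UNIV. \<Sum>r\<in>UNIV. y $ Some (r, s)) / (real CARD('k) * real CARD('n))"
        (is "?L = _")
      proof -
        have "?L = (\<Sum>r\<in>UNIV. (if p = r then 1 else 0) * (\<Sum>s\<in>UNIV. (if q = s then 1 else 0) * y $ Some (r, s)))
          - (\<Sum>r\<in>UNIV. (\<Sum>s\<in>UNIV. (if q = s then 1 else 0) * y $ Some (r, s)) / real CARD('k))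
          - (\<Sum>r\<in>UNIV. (if p = r then 1 else 0) * (\<Sum>s\<in>UNIV. y $ Some (r, s) / real CARD('n)))
          + (\<Sum>r\<in>UNIV. (\<Sum>s\<in>UNIV. y $ Some (r, s) / (real CARD('k) * real CARD('n))))"
          unfolding Lk(2) Ln(2) sum_distrib_left sum_divide_distrib sum.distrib[symmetric] sum_subtractf[symmetric]
          by (intro sum.cong refl) (simp add: mat_def outer_def ones_def algebra_simps)
        also have "(\<Sum>r\<in>UNIV. \<Sum>s\<in>UNIV. y $ Some (r, s) / (real CARD('k) * real CARD('n)))
           = (\<Sum>s\<in>UNIV. \<Sum>r\<in>UNIV. y $ Some (r, s)) / (real CARD('k) * real CARD('n))"
          unfolding sum_divide_distrib by (rule sum.swap)
        finally show ?thesis unfolding if_one_zero_mult by (simp add: sum_divide_distrib)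
      qed
      also have "\<dots> = y $ Some (p, q) - real (m $ p) / real CARD('n) * y $ None"
        using y by (simp add: consistent_def)
      finally show ?thesis by (simp add: Vhat_Some LNone)
    qed
    then have "(Vhat m Vk Vn *v (L *v y)) $ i = y $ i" for i
      by (cases i) (auto simp: Vhat_None LNone)
    then show ?thesis by (simp add: vec_eq_iff)
  qed
  moreover have "L ** Vhat m Vk Vn = mat 1"
  proof (rule matrix_eq[THEN iffD2], rule allI)
    fix z
    \<comment> \<open>\<open>Ln = Ln Vn Ln\<close>, and \<open>Vn Ln\<close> is the projection that annihilates \<open>ones\<close>.\<close>
    have Ln0: "(\<Sum>q\<in>UNIV. Ln $ b $ q) = 0" for b
    proof -
      have "Ln *v ones = (Ln ** Vn ** Ln) *v ones" by (simp add: Ln(1))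
      also have "\<dots> = Ln *v ((Vn ** Ln) *v ones)" by (simp only: matrix_vector_mul_assoc matrix_mul_assoc)
      also have "(Vn ** Ln) *v ones = 0"
        by (simp add: Ln(2) matrix_vector_mult_diff_rdistrib scaleR_matrix_vector_assoc[symmetric] outer_mult)
           (simp add: ones_def inner_vec_def)
      finally show ?thesis by (simp add: ones_def matrix_vector_mult_def vec_eq_iff)
    qed
    have "(L *v (Vhat m Vk Vn *v z)) $ Some (a, b) = z $ Some (a, b)" for a b
    proof -
      have "(L *v (Vhat m Vk Vn *v z)) $ Some (a, b) =
         (\<Sum>p\<in>UNIV. \<Sum>q\<in>UNIV. Lk $ a $ p * Ln $ b $ q * (real (m $ p) / real CARD('n) * z $ None))
       + (\<Sum>p\<in>UNIV. \<Sum>q\<in>UNIV. Lk $ a $ p * Ln $ b $ q * (\<Sum>c\<in>UNIV. \<Sum>d\<in>UNIV. Vk $ p $ c * Vn $ q $ d * z $ Some (c, d)))"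
        unfolding LSome Vhat_Some by (simp add: distrib_left sum.distrib)
      also have "(\<Sum>p\<in>UNIV. \<Sum>q\<in>UNIV. Lk $ a $ p * Ln $ b $ q * (real (m $ p) / real CARD('n) * z $ None)) = 0"
        by (simp only: Ln0 mult_zero_left mult_zero_right sum.neutral_const
            flip: sum_distrib_left sum_distrib_right)
      also have "(\<Sum>p\<in>UNIV. \<Sum>q\<in>UNIV. Lk $ a $ p * Ln $ b $ q * (\<Sum>c\<in>UNIV. \<Sum>d\<in>UNIV. Vk $ p $ c * Vn $ q $ d * z $ Some (c, d)))
         = (\<Sum>c\<in>UNIV. \<Sum>d\<in>UNIV. (Lk ** Vk) $ a $ c * (Ln ** Vn) $ b $ d * z $ Some (c, d))"
        by (rule kron_sum_compose)
      also have "\<dots> = (\<Sum>c\<in>UNIV. if a = c then \<Sum>d\<in>UNIV. if b = d then z $ Some (c, d) else 0 else 0)"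
        unfolding Lk(1) Ln(1) by (intro sum.cong refl) (simp add: mat_def if_one_zero_mult)
      finally show ?thesis by simp
    qed
    then have "(L *v (Vhat m Vk Vn *v z)) $ i = z $ i" for i
      by (cases i) (auto simp: Vhat_None LNone)
    then show "(L ** Vhat m Vk Vn) *v z = mat 1 *v z"
      by (simp add: vec_eq_iff flip: matrix_vector_mul_assoc)
  qed
  ultimately show thesis using that by blast
qed

section \<open>Facial reduction and the redundant constraints\<close>

definition assignment_normal :: "'n \<Rightarrow> real^(('k::finite \<times> 'n::finite) option)" where
  "assignment_normal q = (\<chi> i. case i of None \<Rightarrow> - 1 | Some (p, s) \<Rightarrow> if s = q then 1 else 0)"

definition size_normal :: "nat^'k::finite \<Rightarrow> 'k \<Rightarrow> real^(('k \<times> 'n::finite) option)" where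
  "size_normal m p = (\<chi> i. case i of None \<Rightarrow> - real (m $ p) | Some (r, s) \<Rightarrow> if r = p then 1 else 0)"

lemma assignment_normal_inner:
  "assignment_normal q \<bullet> y = (\<Sum>p\<in>UNIV. y $ Some (p, q)) - y $ None"
  by (simp add: inner_vec_def sum_option_prod assignment_normal_def if_one_zero_mult)

lemma size_normal_inner:
  "size_normal m p \<bullet> y = (\<Sum>q\<in>UNIV. y $ Some (p, q)) - real (m $ p) * y $ None"
proof -
  have "(\<Sum>r\<in>UNIV. \<Sum>s\<in>UNIV. (if r = p then 1 else 0) * y $ Some (r, s))
      = (\<Sum>r\<in>UNIV. if r = p then (\<Sum>s\<in>UNIV. y $ Some (r, s)) else 0)"
    by (intro sum.cong refl) simp
  then show ?thesis
    by (simp add: inner_vec_def sum_option_prod size_normal_def)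
qed

lemma consistent_iff_normals:
  "consistent m y \<longleftrightarrow> (\<forall>q. assignment_normal q \<bullet> y = 0) \<and> (\<forall>p. size_normal m p \<bullet> y = 0)"
  by (simp add: consistent_def assignment_normal_inner size_normal_inner)

text \<open>
  \<open>D1\<close> and \<open>D2\<close> are the sums of squares of the assignment and of the size equations.  This is why a single
  scalar equation \<open>trace (D ** Y) = 0\<close> forces all of them on the range of a positive semidefinite \<open>Y\<close>.
\<close>

lemma D1_eq_sum_outer:
  "D1 = (\<Sum>q\<in>UNIV. outer (assignment_normal q) (assignment_normal q)
     :: real^(('k::finite \<times> 'n::finite) option)^(('k \<times> 'n) option))"
proof -
  have "D1 $ i $ j = (\<Sum>q\<in>UNIV. assignment_normal q $ i * assignment_normal q $ j)"
    for i j :: "('k \<times> 'n) option"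
    by (cases i; cases j)
       (auto simp: D1_def bordered_def assignment_normal_def kronv_def kron_def outer_def ones_def mat_def
         if_one_zero_mult sum_negf)
  then show ?thesis by (simp add: vec_eq_iff outer_def)
qed

lemma D2_eq_sum_outer:
  "D2 m = (\<Sum>p\<in>UNIV. outer (size_normal m p) (size_normal m p)
     :: real^(('k::finite \<times> 'n::finite) option)^(('k \<times> 'n) option))"
proof -
  have "(D2 m :: real^(('k::finite \<times> 'n::finite) option)^(('k \<times> 'n) option)) $ i $ j
      = (\<Sum>q\<in>UNIV. size_normal m q $ i * size_normal m q $ j)"
    for i j :: "('k \<times> 'n) option"
    by (cases i; cases j)
       (auto simp: D2_def bordered_def size_normal_def kronv_def kron_def outer_def ones_def mat_def mvec_def
         inner_vec_def if_one_zero_mult sum_negf)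
  then show ?thesis by (simp add: vec_eq_iff outer_def)
qed

lemma trace_sum_outer:
  fixes a :: "'q::finite \<Rightarrow> real^'n"
  assumes "D = (\<Sum>q\<in>UNIV. outer (a q) (a q))"
  shows "trace (D ** Y) = (\<Sum>q\<in>UNIV. a q \<bullet> (Y *v a q))"
proof -
  have "trace (D ** Y) = transpose Y \<bullet> D"
    by (simp add: trace_mult_inner inner_commute)
  also have "\<dots> = (\<Sum>q\<in>UNIV. a q \<bullet> (transpose Y *v a q))"
    by (simp add: assms inner_sum_right inner_outer del: transpose_matrix_vector)
  also have "\<dots> = (\<Sum>q\<in>UNIV. a q \<bullet> (Y *v a q))"
    by (simp add: quadform_transpose[of _ "transpose Y"] inner_commute del: transpose_matrix_vector)
  finally show ?thesis .
qed

lemma psd_trace_outer_zero: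
  fixes a :: "'q::finite \<Rightarrow> real^'n"
  assumes "psd Y" "D = (\<Sum>q\<in>UNIV. outer (a q) (a q))" "trace (D ** Y) = 0"
  shows "Y *v a q = 0"
proof (rule psd_null[OF assms(1)])
  have "(\<Sum>q\<in>UNIV. a q \<bullet> (Y *v a q)) = 0" using assms trace_sum_outer by metis
  then show "a q \<bullet> (Y *v a q) = 0"
    using assms(1) by (subst (asm) sum_nonneg_eq_0_iff) (auto simp: psd_def)
qed

lemma gangster_J_zero_iff:
  "gangster J Y = 0 \<longleftrightarrow> (\<forall>p r q. p \<noteq> r \<longrightarrow> Y $ Some (p, q) $ Some (r, q) = 0)"
  for Y :: "real^(('k::{finite,linorder} \<times> 'n::finite) option)^(('k \<times> 'n) option)"
proof
  assume g: "gangster J Y = 0"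
  show "\<forall>p r q. p \<noteq> r \<longrightarrow> Y $ Some (p, q) $ Some (r, q) = 0"
  proof (intro allI impI)
    fix p r :: 'k and q :: 'n assume "p \<noteq> r"
    then have "(Some (p, q), Some (r, q)) \<in> J \<or> (Some (r, q), Some (p, q)) \<in> J"
      by (auto simp: J_def)
    moreover have "gangster J Y $ Some (p, q) $ Some (r, q) = 0" by (simp add: g)
    ultimately show "Y $ Some (p, q) $ Some (r, q) = 0" by (simp add: gangster_def split: if_splits)
  qed
qed (auto simp: gangster_def vec_eq_iff J_def)

lemma gangster_Jbar_iff:
  "gangster Jbar Y = gangster Jbar (outer e0 e0) \<longleftrightarrow> Y $ None $ None = 1 \<and> gangster J Y = 0"
  for Y :: "real^(('k::{finite,linorder} \<times> 'n::finite) option)^(('k \<times> 'n) option)"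
proof -
  have "gangster Jbar Y = gangster Jbar (outer e0 e0) \<longleftrightarrow>
    (\<forall>i j. (i, j) \<in> Jbar \<or> (j, i) \<in> Jbar \<longrightarrow> Y $ i $ j = outer e0 e0 $ i $ j)"
    by (auto simp: gangster_def vec_eq_iff)
  also have "\<dots> \<longleftrightarrow> Y $ None $ None = 1 \<and> gangster J Y = 0"
    by (auto simp: gangster_def vec_eq_iff Jbar_def J_def outer_def e0_def axis_def)
  finally show ?thesis .
qed

locale partition_reduction =
  fixes m :: "nat^'k::{finite,linorder}"
    and Vk :: "real^'k1::finite^'k::{finite,linorder}"
    and Vn :: "real^'n1::finite^'n::finite"
  assumes sizes: "(\<Sum>i\<in>UNIV. m $ i) = CARD('n)" and Vk: "is_V Vk" and Vn: "is_V Vn"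
begin

abbreviation V where "V \<equiv> Vhat m Vk Vn"

lemma consistent_lift: "consistent m (lift V Z *v y)"
  by (simp add: lift_def consistent_Vhat sizes Vk Vn flip: matrix_vector_mul_assoc)

lemma lift_row_consistent:
  assumes "sym_mat Z"
  shows "consistent m (\<chi> j. lift V Z $ i $ j)"
proof -
  have "(\<chi> j. lift V Z $ i $ j) = lift V Z *v axis i 1"
    using sym_mat_lift[OF assms, of V] by (simp add: matrix_vector_mult_basis column_def sym_mat_nth)
  then show ?thesis by (simp add: consistent_lift)
qed

lemma lift_row_sum:
  assumes "sym_mat Z"
  shows "(\<Sum>p\<in>UNIV. lift V Z $ i $ Some (p, q)) = lift V Z $ i $ None"
    "(\<Sum>q\<in>UNIV. lift V Z $ i $ Some (p, q)) = real (m $ p) * lift V Z $ i $ None"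
  using lift_row_consistent[OF assms, of i] by (auto simp: consistent_def)

text \<open>
  With \<open>L\<close> the left inverse of \<open>Vhat\<close>, the matrix \<open>Vhat L\<close> fixes the columns of \<open>Y\<close>, and by symmetry also its
  rows, so \<open>Z = L Y L\<^sup>T\<close> works.
\<close>

lemma lift_eq_of_consistent:
  assumes "psd Y" "\<And>j. consistent m (Y *v axis j 1)"
  shows "\<exists>Z. psd Z \<and> lift V Z = Y"
proof -
  obtain L where L: "\<And>y. consistent m y \<Longrightarrow> V *v (L *v y) = y"
    using Vhat_left_inverse[OF Vk Vn] by metis
  have "(V ** L ** Y) *v axis j 1 = Y *v axis j 1" for j
    using L[OF assms(2)] by (simp flip: matrix_vector_mul_assoc)
  then have VLY: "V ** L ** Y = Y"
    by (simp add: matrix_vector_mult_basis column_def vec_eq_iff)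
  moreover have "Y ** transpose (V ** L) = Y"
    using assms(1) arg_cong[OF VLY, of transpose]
    by (simp add: psd_def sym_mat_def matrix_transpose_mul)
  ultimately have "lift (V ** L) Y = Y" by (simp add: lift_def)
  then have "lift V (lift L Y) = Y" by (simp add: lift_lift)
  then show ?thesis using psd_lift[OF assms(1)] by blast
qed

text \<open>
  In the row \<open>(p, q)\<close> of \<open>Y\<close> the entries \<open>(r, q)\<close> sum to the entry \<open>0\<close>, and the gangster constraint leaves only
  \<open>r = p\<close> in this sum; hence the diagonal of \<open>Y\<close> equals its row \<open>0\<close>.  The remaining constraints read off the
  assignment and size equations of the row \<open>0\<close>.
\<close>

lemma final_constraints:
  assumes Z: "feasible_final m Vk Vn Z"
  defines "Y \<equiv> lift V Z"
  shows "psd Y" "Y $ None $ None = 1" "gangster J Y = 0"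
    and "\<And>p q. Y $ Some (p, q) $ Some (p, q) = Y $ None $ Some (p, q)"
    and "arrow Y = e0" "DO Y = Diag (mvec m)" "De Y = ones"
proof -
  have psdZ: "psd Z" and g: "Y $ None $ None = 1 \<and> gangster J Y = 0"
    using Z unfolding feasible_final_def gangster_Jbar_iff Y_def by auto
  then have symZ: "sym_mat Z" by (simp add: psd_def)
  show "psd Y" by (simp add: Y_def psd_lift psdZ)
  then have symY: "Y $ i $ j = Y $ j $ i" for i j by (simp add: psd_def sym_mat_nth)
  show Y00: "Y $ None $ None = 1" and "gangster J Y = 0" using g by auto
  then have off: "p \<noteq> r \<Longrightarrow> Y $ Some (p, q) $ Some (r, q) = 0" for p r q
    by (simp add: gangster_J_zero_iff)
  note row = lift_row_sum[OF symZ, folded Y_def]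
  show dia: "Y $ Some (p, q) $ Some (p, q) = Y $ None $ Some (p, q)" for p q
  proof -
    have "Y $ Some (p, q) $ None = (\<Sum>r\<in>UNIV. Y $ Some (p, q) $ Some (r, q))"
      by (simp add: row)
    also have "\<dots> = (\<Sum>r\<in>UNIV. if p = r then Y $ Some (p, q) $ Some (p, q) else 0)"
      by (intro sum.cong refl) (auto simp: off)
    finally show ?thesis by (simp add: symY[of None])
  qed
  have "arrow Y $ i = e0 $ i" for i
    by (cases i) (auto simp: arrow_def diag_def dia e0_def axis_def Y00)
  then show "arrow Y = e0" by (simp add: vec_eq_iff)
  have "DO Y $ i $ j = Diag (mvec m) $ i $ j" for i j
    by (cases "i = j") (auto simp: DO_def trace_def block_def Diag_def mvec_def off dia row Y00)
  then show "DO Y = Diag (mvec m)" by (simp add: vec_eq_iff)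
  show "De Y = ones"
    by (simp add: De_def vec_eq_iff diag_def block_def ones_def dia row Y00)
qed

lemma feasible_reduced_iff_final: "feasible_reduced m Vk Vn Z \<longleftrightarrow> feasible_final m Vk Vn Z"
proof
  assume "feasible_reduced m Vk Vn Z"
  then show "feasible_final m Vk Vn Z"
    unfolding feasible_final_def feasible_reduced_def gangster_Jbar_iff by (simp add: Let_def)
next
  assume F: "feasible_final m Vk Vn Z"
  then show "feasible_reduced m Vk Vn Z"
    using final_constraints[OF F] by (simp add: feasible_reduced_def Let_def feasible_final_def)
qed

text \<open>
  Facial reduction: the two trace constraints put \<open>Y\<close> into the face of matrices with consistent range,
  and this face is the image of the smaller cone under \<open>lift Vhat\<close>.
\<close>

lemma feasible_SDP_iff: "feasible_SDP m Y \<longleftrightarrow> (\<exists>Z. feasible_final m Vk Vn Z \<and> Y = lift V Z)"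
proof
  assume Y: "feasible_SDP m Y"
  then have p: "psd Y" by (simp add: feasible_SDP_def)
  have "Y *v assignment_normal q = 0" for q
    by (rule psd_trace_outer_zero[OF p D1_eq_sum_outer]) (use Y in \<open>simp add: feasible_SDP_def\<close>)
  moreover have "Y *v size_normal m r = 0" for r
    by (rule psd_trace_outer_zero[OF p D2_eq_sum_outer]) (use Y in \<open>simp add: feasible_SDP_def\<close>)
  ultimately have "consistent m (Y *v x)" for x
    using p by (simp add: consistent_iff_normals psd_def sym_quadform_commute[of Y _ x])
  then obtain Z where Z: "psd Z" "lift V Z = Y"
    using lift_eq_of_consistent[OF p] by blast
  then have "feasible_final m Vk Vn Z"
    using Y unfolding feasible_final_def gangster_Jbar_iff by (simp add: feasible_SDP_def)
  then show "\<exists>Z. feasible_final m Vk Vn Z \<and> Y = lift V Z" using Z by blast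
next
  assume "\<exists>Z. feasible_final m Vk Vn Z \<and> Y = lift V Z"
  then obtain Z where F: "feasible_final m Vk Vn Z" and Y: "Y = lift V Z" by blast
  have "trace (D1 ** Y) = 0" "trace (D2 m ** Y) = 0"
    unfolding trace_sum_outer[OF D1_eq_sum_outer] trace_sum_outer[OF D2_eq_sum_outer] Y
    using consistent_lift unfolding consistent_iff_normals by simp_all
  then show "feasible_SDP m Y"
    using final_constraints[OF F] by (simp add: feasible_SDP_def Y)
qed

lemma obj_final_eq: "obj_final G m Vk Vn Z = 1 / 2 * trace (LG G ** lift V Z)"
  by (simp add: obj_final_def trace_mult_inner reduce_adjoint transpose_lift)

text \<open>
  By the arrow constraint \<open>Y\<^sub>a\<^sub>a = Y\<^sub>0\<^sub>a \<le> (1 + Y\<^sub>a\<^sub>a) / 2\<close>, hence \<open>Y\<^sub>a\<^sub>a \<le> 1\<close>.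
\<close>

lemma feasible_final_entry_bound:
  assumes "feasible_final m Vk Vn Z"
  shows "\<bar>lift V Z $ i $ j\<bar> \<le> 1"
proof -
  note c = final_constraints[OF assms]
  have "lift V Z $ i $ i \<le> 1" for i
  proof (cases i)
    case (Some a)
    then show ?thesis
      using psd_entry_bound[OF c(1), of None i] c(2) c(4)[of "fst a" "snd a"] by simp
  qed (simp add: c)
  then show ?thesis using psd_entry_bound[OF c(1), of i j] by (smt (verit))
qed

text \<open>
  Boundedness passes from the lifted matrices back to \<open>Z\<close> through the left inverse of \<open>Vhat\<close>.
\<close>

lemma compact_feasible_final: "compact {Z. feasible_final m Vk Vn Z}"
proof -
  obtain L where L: "L ** V = mat 1" using Vhat_left_inverse[OF Vk Vn] by metis
  have "bounded (lift V ` {Z. feasible_final m Vk Vn Z})"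
    by (rule bounded_matrix_entries[of _ 1]) (auto simp: feasible_final_entry_bound)
  then have "bounded (lift L ` lift V ` {Z. feasible_final m Vk Vn Z})"
    by (rule bounded_linear_image) (simp add: linear_lift linear_conv_bounded_linear[symmetric])
  moreover have "lift L (lift V Z) = Z" for Z
    by (simp add: lift_lift L) (simp add: lift_def transpose_mat)
  ultimately have "bounded {Z. feasible_final m Vk Vn Z}" by (simp add: image_image)
  moreover have "closed {Z. feasible_final m Vk Vn Z}"
  proof -
    have lin: "linear (\<lambda>Z. gangster Jbar (lift V Z))"
      using linear_compose[OF linear_lift linear_gangster] by (simp add: o_def)
    have "{Z. feasible_final m Vk Vn Z} =
      {Z. gangster Jbar (lift V Z) = gangster Jbar (outer e0 e0)} \<inter> {Z. psd Z}"
      by (auto simp: feasible_final_def)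
    also have "closed \<dots>"
      by (intro closed_Int closed_psd closed_Collect_eq continuous_intros
          linear_continuous_on) (use lin in \<open>simp add: linear_conv_bounded_linear\<close>)
    finally show ?thesis .
  qed
  ultimately show ?thesis by (simp add: compact_eq_bounded_closed)
qed

lemma linear_obj_final: "linear (obj_final G m Vk Vn)"
proof -
  have "obj_final G m Vk Vn = (\<lambda>Z. 1 / 2 * (transpose (LG G) \<bullet> lift V Z))"
    unfolding fun_eq_iff obj_final_eq
    by (subst trace_mul_sym) (simp add: trace_mult_inner inner_commute)
  moreover have "linear (\<lambda>Z. 1 / 2 * (transpose (LG G) \<bullet> lift V Z))"
    using linear_add[OF linear_lift[of V]] linear_scale[OF linear_lift[of V]]
    by (intro linearI) (auto simp: inner_add_right algebra_simps)
  ultimately show ?thesis by simp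
qed

lemma p_SDP_attained:
  assumes "feasible_final m Vk Vn Z0"
  shows "\<exists>Z. is_arg_min (obj_final G m Vk Vn) (feasible_final m Vk Vn) Z
         \<and> p_SDP G m = ereal (obj_final G m Vk Vn Z)"
proof -
  have "continuous_on {Z. feasible_final m Vk Vn Z} (obj_final G m Vk Vn)"
    by (intro linear_continuous_on) (simp add: linear_obj_final linear_conv_bounded_linear[symmetric])
  then obtain Z where Z: "feasible_final m Vk Vn Z"
    and min: "\<And>Z'. feasible_final m Vk Vn Z' \<Longrightarrow> obj_final G m Vk Vn Z \<le> obj_final G m Vk Vn Z'"
    using continuous_attains_inf[OF compact_feasible_final] assms by (metis (mono_tags, lifting) empty_iff mem_Collect_eq)
  have "p_SDP G m = ereal (obj_final G m Vk Vn Z)"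
    unfolding p_SDP_def
  proof (rule antisym)
    show "(INF Y\<in>{Y :: real^(('k \<times> 'n) option)^(('k \<times> 'n) option). feasible_SDP m Y}.
        ereal (1 / 2 * trace (LG G ** Y))) \<le> ereal (obj_final G m Vk Vn Z)"
      by (rule INF_lower2[of "lift V Z"]) (use Z in \<open>auto simp: feasible_SDP_iff obj_final_eq\<close>)
    show "ereal (obj_final G m Vk Vn Z) \<le> (INF Y\<in>{Y :: real^(('k \<times> 'n) option)^(('k \<times> 'n) option). feasible_SDP m Y}.
        ereal (1 / 2 * trace (LG G ** Y)))"
      by (rule INF_greatest) (use min in \<open>auto simp: feasible_SDP_iff obj_final_eq\<close>)
  qed
  moreover have "is_arg_min (obj_final G m Vk Vn) (feasible_final m Vk Vn) Z"
    using Z min by (auto simp: is_arg_min_def not_less)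
  ultimately show ?thesis by blast
qed

end

section \<open>The primal Slater point\<close>

text \<open>
  Lagrange's identity for a covariance, in the form of a double sum over pairs of indices.  For \<open>u = v\<close> it
  is a sum of squares: with unit weights it gives the form of \<open>n I - e e\<^sup>T\<close>, with weights \<open>m\<close> that of
  \<open>n Diag m - m m\<^sup>T\<close>.
\<close>

lemma weighted_covariance:
  fixes u v w :: "'a \<Rightarrow> real"
  assumes "finite A"
  shows "(\<Sum>i\<in>A. w i) * (\<Sum>i\<in>A. w i * (u i * v i)) - (\<Sum>i\<in>A. w i * u i) * (\<Sum>i\<in>A. w i * v i)
     = (1/2) * (\<Sum>i\<in>A. \<Sum>j\<in>A. w i * w j * ((u i - u j) * (v i - v j)))"
proof -
  have "(\<Sum>i\<in>A. \<Sum>j\<in>A. w i * w j * ((u i - u j) * (v i - v j)))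
     = (\<Sum>i\<in>A. \<Sum>j\<in>A. (w i * (u i * v i)) * w j) + (\<Sum>i\<in>A. \<Sum>j\<in>A. w i * (w j * (u j * v j)))
      - (\<Sum>i\<in>A. \<Sum>j\<in>A. (w i * u i) * (w j * v j)) - (\<Sum>i\<in>A. \<Sum>j\<in>A. (w i * v i) * (w j * u j))"
    unfolding sum.distrib[symmetric] sum_subtractf[symmetric]
    by (intro sum.cong refl) (simp add: algebra_simps)
  also have "\<dots> = 2 * ((\<Sum>i\<in>A. w i) * (\<Sum>i\<in>A. w i * (u i * v i)) - (\<Sum>i\<in>A. w i * u i) * (\<Sum>i\<in>A. w i * v i))"
    unfolding sum_product[symmetric] by (simp add: algebra_simps)
  finally show ?thesis by simp
qed

text \<open>
  The average of \<open>y y\<^sup>T\<close> over all ordered partitions, split into the square of the mean \<open>\<mu>\<close> and the covariance.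
  Under a random partition node \<open>q\<close> lies in set \<open>p\<close> with probability \<open>m\<^sub>p / n\<close>, and drawing without replacement
  gives the covariance \<open>(n Diag m - m m\<^sup>T) \<otimes> (n I - e e\<^sup>T) / (n\<^sup>2 (n - 1))\<close>.
\<close>

definition barycenter :: "nat^'k::finite \<Rightarrow> real^(('k \<times> 'n::finite) option)^(('k \<times> 'n) option)" where
  "barycenter m = (let n = real CARD('n); \<mu> = (\<lambda>i. case i of None \<Rightarrow> 1 | Some (p, q) \<Rightarrow> real (m $ p) / n)
    in \<chi> i j. \<mu> i * \<mu> j + (case (i, j) of
        (Some (p, q), Some (r, s)) \<Rightarrow>
          ((if p = r then n * real (m $ p) else 0) - real (m $ p) * real (m $ r))
          * ((if q = s then n else 0) - 1) / (n\<^sup>2 * (n - 1))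
      | _ \<Rightarrow> 0))"

lemma barycenter_nth:
  fixes m :: "nat^'k::finite"
  defines "n \<equiv> real CARD('n::finite)" and "Y \<equiv> (barycenter m :: real^(('k \<times> 'n) option)^(('k \<times> 'n) option))"
  shows "Y $ None $ None = 1"
    "Y $ None $ Some (r, s) = real (m $ r) / n"
    "Y $ Some (p, q) $ None = real (m $ p) / n"
    "Y $ Some (p, q) $ Some (r, s) = real (m $ p) * real (m $ r) / n\<^sup>2
       + ((if p = r then n * real (m $ p) else 0) - real (m $ p) * real (m $ r))
          * ((if q = s then n else 0) - 1) / (n\<^sup>2 * (n - 1))"
  by (simp_all add: barycenter_def Let_def Y_def n_def power2_eq_square)

text \<open>
  Up to a factor the covariance part of the quadratic form of \<open>barycenter\<close>: a weighted sum of the squares of all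
  mixed second differences of the array \<open>(w\<^sub>p\<^sub>q)\<close>, which for positive sizes
  vanish together only for arrays \<open>a\<^sub>p + b\<^sub>q\<close>.
\<close>

definition interaction :: "nat^'k::finite \<Rightarrow> real^(('k \<times> 'n::finite) option) \<Rightarrow> real" where
  "interaction m w = (\<Sum>q\<in>UNIV. \<Sum>s\<in>UNIV. \<Sum>p\<in>UNIV. \<Sum>r\<in>UNIV. real (m $ p) * real (m $ r) *
        ((w $ Some (p, q) - w $ Some (p, s)) - (w $ Some (r, q) - w $ Some (r, s)))\<^sup>2)"

lemma interaction_nonneg: "0 \<le> interaction m w"
  by (simp add: interaction_def sum_nonneg)

lemma interaction_zero:
  assumes "interaction m w = 0" "\<forall>i. m $ i > 0"
  shows "w $ Some (p, q) - w $ Some (p, s) = w $ Some (r, q) - w $ Some (r, s)"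
  using assms unfolding interaction_def
  by (simp add: sum_nonneg_eq_0_iff sum_nonneg) (metis (no_types, lifting) less_numeral_extra(3))

text \<open>
  The covariance is a Kronecker product, so \<open>weighted_covariance\<close> applies once in the node index (turning
  the form into pairwise differences over nodes) and once in the set index.
\<close>

lemma barycenter_quadform:
  fixes m :: "nat^'k::finite" and w :: "real^(('k \<times> 'n::finite) option)"
  defines "n \<equiv> real CARD('n)"
  assumes sizes: "(\<Sum>i\<in>UNIV. m $ i) = CARD('n)"
  shows "w \<bullet> (barycenter m *v w) =
     (w $ None + (\<Sum>p\<in>UNIV. \<Sum>q\<in>UNIV. real (m $ p) / n * w $ Some (p, q)))\<^sup>2
     + interaction m w / (4 * n\<^sup>2 * (n - 1))"
proof -
  define x where "x p q = w $ Some (p, q)" for p q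
  define \<mu> where "\<mu> p = real (m $ p)" for p
  have \<mu>: "(\<Sum>p\<in>UNIV. \<mu> p) = n" using sizes unfolding \<mu>_def n_def by (metis of_nat_sum)
  define Q where "Q u v = n * (\<Sum>q\<in>UNIV. u q * v q) - (\<Sum>q\<in>UNIV. u q) * (\<Sum>s\<in>UNIV. v s)" for u v :: "'n \<Rightarrow> real"
  have Q: "Q u v = (1/2) * (\<Sum>q\<in>UNIV. \<Sum>s\<in>UNIV. (u q - u s) * (v q - v s))" for u v
    using weighted_covariance[of UNIV "\<lambda>_. 1" u v] by (simp add: Q_def n_def)
  \<comment> \<open>\<open>Q\<close> is the bilinear form of \<open>n I - e e\<^sup>T\<close>, and \<open>P\<close> below treats \<open>n Diag m - m m\<^sup>T\<close>.\<close>
  have Q': "(\<Sum>q\<in>UNIV. \<Sum>s\<in>UNIV. ((if q = s then n else 0) - 1) * (u q * v s)) = Q u v" for u v :: "'n \<Rightarrow> real"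
  proof -
    have "(\<Sum>q\<in>UNIV. \<Sum>s\<in>UNIV. ((if q = s then n else 0) - 1) * (u q * v s))
       = (\<Sum>q\<in>UNIV. (\<Sum>s\<in>UNIV. if q = s then n * (u q * v s) else 0)) - (\<Sum>q\<in>UNIV. \<Sum>s\<in>UNIV. u q * v s)"
      unfolding sum_subtractf[symmetric] by (intro sum.cong refl) (simp add: algebra_simps)
    then show ?thesis unfolding Q_def sum_product by (simp add: sum_distrib_left)
  qed
  have P: "(\<Sum>p\<in>UNIV. \<Sum>r\<in>UNIV. ((if p = r then n * \<mu> p else 0) - \<mu> p * \<mu> r) * (u p * u r))
     = (1/2) * (\<Sum>p\<in>UNIV. \<Sum>r\<in>UNIV. \<mu> p * \<mu> r * (u p - u r)\<^sup>2)" for u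
  proof -
    have "(\<Sum>p\<in>UNIV. \<Sum>r\<in>UNIV. ((if p = r then n * \<mu> p else 0) - \<mu> p * \<mu> r) * (u p * u r))
       = (\<Sum>p\<in>UNIV. \<Sum>r\<in>UNIV. if p = r then n * (\<mu> p * (u p * u r)) else 0) - (\<Sum>p\<in>UNIV. \<Sum>r\<in>UNIV. (\<mu> p * u p) * (\<mu> r * u r))"
      unfolding sum_subtractf[symmetric] by (intro sum.cong refl) (simp add: algebra_simps)
    then show ?thesis using weighted_covariance[of UNIV \<mu> u u]
      by (simp add: sum_product \<mu> power2_eq_square flip: sum_distrib_left)
  qed
  have "w \<bullet> (barycenter m *v w) = w $ None * w $ None
      + 2 * (w $ None * (\<Sum>p\<in>UNIV. \<Sum>q\<in>UNIV. \<mu> p / n * x p q))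
      + (\<Sum>p\<in>UNIV. \<Sum>q\<in>UNIV. \<Sum>r\<in>UNIV. \<Sum>s\<in>UNIV. (\<mu> p / n * x p q) * (\<mu> r / n * x r s)
          + ((if p = r then n * \<mu> p else 0) - \<mu> p * \<mu> r)
          * (((if q = s then n else 0) - 1) * (x p q * x r s)) / (n\<^sup>2 * (n - 1)))"
    unfolding quadform_sum sum_option_prod barycenter_nth n_def[symmetric] sum.distrib sum_distrib_left
    unfolding x_def \<mu>_def
    by (simp add: sum.distrib sum_distrib_left power2_eq_square algebra_simps)
  also have "(\<Sum>p\<in>UNIV. \<Sum>q\<in>UNIV. \<Sum>r\<in>UNIV. \<Sum>s\<in>UNIV. (\<mu> p / n * x p q) * (\<mu> r / n * x r s)
          + ((if p = r then n * \<mu> p else 0) - \<mu> p * \<mu> r)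
          * (((if q = s then n else 0) - 1) * (x p q * x r s)) / (n\<^sup>2 * (n - 1)))
     = (\<Sum>p\<in>UNIV. \<Sum>q\<in>UNIV. \<mu> p / n * x p q)\<^sup>2
      + (\<Sum>p\<in>UNIV. \<Sum>q\<in>UNIV. \<Sum>r\<in>UNIV. \<Sum>s\<in>UNIV. ((if p = r then n * \<mu> p else 0) - \<mu> p * \<mu> r)
          * (((if q = s then n else 0) - 1) * (x p q * x r s))) / (n\<^sup>2 * (n - 1))"
  proof -
    have "(\<Sum>p\<in>UNIV. \<Sum>q\<in>UNIV. \<mu> p / n * x p q)\<^sup>2
        = (\<Sum>p\<in>UNIV. \<Sum>q\<in>UNIV. \<Sum>r\<in>UNIV. \<Sum>s\<in>UNIV. (\<mu> p / n * x p q) * (\<mu> r / n * x r s))"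
      unfolding power2_eq_square sum_distrib_right by (simp only: sum_distrib_left)
    then show ?thesis by (simp only: sum.distrib sum_divide_distrib)
  qed
  also have "(\<Sum>p\<in>UNIV. \<Sum>q\<in>UNIV. \<Sum>r\<in>UNIV. \<Sum>s\<in>UNIV. ((if p = r then n * \<mu> p else 0) - \<mu> p * \<mu> r)
          * (((if q = s then n else 0) - 1) * (x p q * x r s)))
     = (\<Sum>p\<in>UNIV. \<Sum>r\<in>UNIV. ((if p = r then n * \<mu> p else 0) - \<mu> p * \<mu> r) * Q (x p) (x r))"
    unfolding Q'[symmetric] sum_distrib_left by (intro sum.cong refl, rule sum.swap)
  also have "\<dots> = (1/2) * (\<Sum>p\<in>UNIV. \<Sum>r\<in>UNIV. \<Sum>q\<in>UNIV. \<Sum>s\<in>UNIV.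
        ((if p = r then n * \<mu> p else 0) - \<mu> p * \<mu> r) * ((x p q - x p s) * (x r q - x r s)))"
    unfolding Q sum_distrib_left by (intro sum.cong refl) simp
  also have "(\<Sum>p\<in>UNIV. \<Sum>r\<in>UNIV. \<Sum>q\<in>UNIV. \<Sum>s\<in>UNIV.
        ((if p = r then n * \<mu> p else 0) - \<mu> p * \<mu> r) * ((x p q - x p s) * (x r q - x r s)))
     = (\<Sum>p\<in>UNIV. \<Sum>q\<in>UNIV. \<Sum>s\<in>UNIV. \<Sum>r\<in>UNIV.
        ((if p = r then n * \<mu> p else 0) - \<mu> p * \<mu> r) * ((x p q - x p s) * (x r q - x r s)))"
    by (intro sum.cong refl, subst sum.swap, intro sum.cong refl, rule sum.swap)
  also have "\<dots> = (\<Sum>q\<in>UNIV. \<Sum>s\<in>UNIV. \<Sum>p\<in>UNIV. \<Sum>r\<in>UNIV.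
        ((if p = r then n * \<mu> p else 0) - \<mu> p * \<mu> r) * ((x p q - x p s) * (x r q - x r s)))"
    by (subst sum.swap, intro sum.cong refl, rule sum.swap)
  also have "\<dots> = (\<Sum>q\<in>UNIV. \<Sum>s\<in>UNIV. (1/2) * (\<Sum>p\<in>UNIV. \<Sum>r\<in>UNIV. \<mu> p * \<mu> r * ((x p q - x p s) - (x r q - x r s))\<^sup>2))"
    by (intro sum.cong refl P)
  also have "\<dots> = (1/2) * interaction m w"
    by (simp only: interaction_def x_def \<mu>_def sum_distrib_left)
  finally show ?thesis
    by (simp add: power2_sum power2_eq_square[of "w $ None"] mult.assoc x_def \<mu>_def)
qed

context partition_reduction
begin

lemma consistent_barycenter:
  "consistent m ((barycenter m :: real^(('k \<times> 'n) option)^(('k \<times> 'n) option)) *v axis j 1)"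
proof -
  define n where "n = real CARD('n)"
  have n: "n > 0" by (simp add: n_def)
  have \<mu>: "(\<Sum>p\<in>UNIV. real (m $ p)) = n" using sizes unfolding n_def by (metis of_nat_sum)
  have P: "(\<Sum>p\<in>UNIV. (if p = r then n * real (m $ p) else 0) - real (m $ p) * real (m $ r)) = 0" for r
    by (simp add: sum_subtractf \<mu> flip: sum_distrib_right)
  have Q: "(\<Sum>q\<in>(UNIV::'n set). (if q = s then n else 0) - 1) = 0" for s
    by (simp add: sum_subtractf n_def)
  show ?thesis
  proof (cases j)
    case None
    then show ?thesis using n
      by (simp add: consistent_def matrix_vector_mult_basis column_def barycenter_nth \<mu>
          flip: n_def sum_divide_distrib)
  next
    case (Some rs)
    obtain r s where rs: "rs = (r, s)" by (cases rs)
    show ?thesis unfolding consistent_def matrix_vector_mult_basis column_def Some rs vec_lambda_beta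
      barycenter_nth n_def[symmetric]
    proof (intro conjI allI)
      fix q
      show "(\<Sum>p\<in>UNIV. real (m $ p) * real (m $ r) / n\<^sup>2
       + ((if p = r then n * real (m $ p) else 0) - real (m $ p) * real (m $ r))
          * ((if q = s then n else 0) - 1) / (n\<^sup>2 * (n - 1))) = real (m $ r) / n"
        unfolding sum.distrib sum_divide_distrib[symmetric] sum_distrib_right[symmetric] P \<mu>
        using n by (simp add: power2_eq_square)
    next
      fix p
      show "(\<Sum>q\<in>UNIV. real (m $ p) * real (m $ r) / n\<^sup>2
       + ((if p = r then n * real (m $ p) else 0) - real (m $ p) * real (m $ r))
          * ((if q = s then n else 0) - 1) / (n\<^sup>2 * (n - 1))) = real (m $ p) * (real (m $ r) / n)"
        unfolding sum.distrib sum_divide_distrib[symmetric] sum_distrib_left[symmetric] Q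
        using n by (simp add: power2_eq_square n_def)
    qed
  qed
qed

text \<open>
  The barycenter is feasible and has consistent columns, so it lifts from some positive semidefinite \<open>Z\<close>.  If
  \<open>z = Vhat\<^sup>T w\<close> is in the kernel of \<open>Z\<close>, then \<open>w\<close> is in the kernel of the barycenter; this makes
  \<open>w\<close> an array \<open>a\<^sub>p + b\<^sub>q\<close> that is orthogonal to the first column of \<open>Vhat\<close>.  The other columns of \<open>Vhat\<close>
  annihilate such arrays because the columns of \<open>V\<^sub>k\<close> and \<open>V\<^sub>n\<close> sum to zero, so \<open>z = 0\<close>.
\<close>

lemma primal_slater:
  assumes mpos: "\<forall>i. m $ i > 0" and n2: "CARD('n) > 1"
  shows "\<exists>Z. feasible_final m Vk Vn Z \<and> pd Z"
proof -
  define n where "n = real CARD('n)"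
  have n: "n > 1" using n2 by (simp add: n_def)
  define Y where "Y = (barycenter m :: real^(('k \<times> 'n) option)^(('k \<times> 'n) option))"
  note quad = barycenter_quadform[OF sizes, folded n_def Y_def]
  have sym: "sym_mat Y"
    unfolding sym_mat_nth
  proof (intro allI)
    fix i j show "Y $ i $ j = Y $ j $ i"
      by (cases i; cases j) (auto simp: Y_def barycenter_nth mult.commute)
  qed
  have psdY: "psd Y" using sym n by (simp add: psd_def quad interaction_nonneg)
  have gang: "gangster Jbar Y = gangster Jbar (outer e0 e0)"
    unfolding gangster_Jbar_iff gangster_J_zero_iff using n
    by (simp add: Y_def barycenter_nth flip: n_def)
  obtain L where LV: "L ** V = mat 1"
    using Vhat_left_inverse[OF Vk Vn] by metis
  obtain Z where Z: "psd Z" "lift V Z = Y"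
    using lift_eq_of_consistent[OF psdY] consistent_barycenter by (auto simp: Y_def)
  have "0 < z \<bullet> (Z *v z)" if z: "z \<noteq> 0" for z
  proof (rule ccontr)
    assume c: "\<not> 0 < z \<bullet> (Z *v z)"
    define w where "w = transpose L *v z"
    have "transpose (L ** V) *v z = z" by (simp add: LV transpose_mat)
    then have zw: "z = transpose V *v w"
      by (simp add: w_def matrix_transpose_mul matrix_vector_mul_assoc del: transpose_matrix_vector)
    have "w \<bullet> (Y *v w) \<le> 0" using c by (simp add: quadform_lift zw flip: Z(2))
    then have w0: "w $ None + (\<Sum>p\<in>UNIV. \<Sum>q\<in>UNIV. real (m $ p) / n * w $ Some (p, q)) = 0"
      and S: "interaction m w = 0"
    proof -
      have d: "4 * n\<^sup>2 * (n - 1) > 0" using n by simp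
      have i: "0 \<le> interaction m w / (4 * n\<^sup>2 * (n - 1))"
        using d by (intro divide_nonneg_pos interaction_nonneg)
      have sq: "0 \<le> (w $ None + (\<Sum>p\<in>UNIV. \<Sum>q\<in>UNIV. real (m $ p) / n * w $ Some (p, q)))\<^sup>2"
        by simp
      note le = \<open>w \<bullet> (Y *v w) \<le> 0\<close>[unfolded quad]
      have "(w $ None + (\<Sum>p\<in>UNIV. \<Sum>q\<in>UNIV. real (m $ p) / n * w $ Some (p, q)))\<^sup>2 = 0"
        using le i sq by linarith
      then show "w $ None + (\<Sum>p\<in>UNIV. \<Sum>q\<in>UNIV. real (m $ p) / n * w $ Some (p, q)) = 0"
        by (simp only: zero_eq_power2)
      have "interaction m w / (4 * n\<^sup>2 * (n - 1)) = 0"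
        using le i sq by linarith
      then show "interaction m w = 0" using n by simp
    qed
    note add = interaction_zero[OF S mpos]
    obtain p0 :: 'k and q0 :: 'n where True by blast
    define a where "a p = w $ Some (p, q0)" for p
    define b where "b q = w $ Some (p0, q) - w $ Some (p0, q0)" for q
    have ab: "w $ Some (p, q) = a p + b q" for p q
      using add[of p q q0 p0] by (simp add: a_def b_def)
    have "(transpose V *v w) $ i = 0" for i
    proof (cases i)
      case None
      then show ?thesis using w0
        by (simp add: matrix_vector_mult_def transpose_def sum_option_prod Vhat_def bordered_def
            kronv_def mvec_def ones_def n_def del: transpose_matrix_vector)
    next
      case (Some cd)
      obtain c d where cd: "cd = (c, d)" by (cases cd)
      have "(transpose V *v w) $ i = (\<Sum>p\<in>UNIV. \<Sum>q\<in>UNIV. Vk $ p $ c * Vn $ q $ d * (a p + b q))"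
        by (simp add: Some cd matrix_vector_mult_def transpose_def sum_option_prod Vhat_def bordered_def
            kron_def ab del: transpose_matrix_vector)
      also have "\<dots> = (\<Sum>p\<in>UNIV. Vk $ p $ c * a p) * (\<Sum>q\<in>UNIV. Vn $ q $ d)
          + (\<Sum>p\<in>UNIV. Vk $ p $ c) * (\<Sum>q\<in>UNIV. Vn $ q $ d * b q)"
        unfolding sum_product sum.distrib[symmetric] by (intro sum.cong refl) (simp add: algebra_simps)
      finally show ?thesis by (simp add: is_V_col_sum Vk Vn)
    qed
    then have "z = 0" unfolding zw by (simp add: vec_eq_iff del: transpose_matrix_vector)
    with z show False by simp
  qed
  then have "pd Z" using Z(1) by (simp add: pd_def psd_def)
  moreover have "feasible_final m Vk Vn Z"
    unfolding feasible_final_def Z(2) using gang Z(1) by simp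
  ultimately show ?thesis by blast
qed

end

section \<open>The dual program\<close>

lemma quadform_norm_bound:
  fixes A :: "real^'n^'n"
  obtains c where "\<And>x. \<bar>x \<bullet> (A *v x)\<bar> \<le> c * (x \<bullet> x)"
proof -
  obtain c where c: "\<And>x. norm (A *v x) \<le> norm x * c"
    using bounded_linear.bounded[OF matrix_vector_mul_bounded_linear[of A]] by blast
  have "\<bar>x \<bullet> (A *v x)\<bar> \<le> c * (x \<bullet> x)" for x
  proof -
    have "\<bar>x \<bullet> (A *v x)\<bar> \<le> norm x * norm (A *v x)" by (rule Cauchy_Schwarz_ineq2)
    also have "\<dots> \<le> norm x * (norm x * c)" by (intro mult_left_mono c) simp
    finally show ?thesis by (simp add: power2_eq_square mult_ac flip: power2_norm_eq_inner)
  qed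
  then show thesis using that by blast
qed

lemma sym_LG: "sym_mat G \<Longrightarrow> sym_mat (LG G)"
  by (auto simp: sym_mat_nth LG_def bordered_def kron_def Bmat_def split: option.splits)

context partition_reduction
begin

lemma sym_mat_slack:
  assumes "sym_mat G" "sym_mat W"
  shows "sym_mat (reduce V (LG G) - reduce V (gangster Jbar W))"
  using sym_mat_lift[OF sym_LG[OF assms(1)], of "transpose V"]
    sym_mat_lift[OF sym_mat_gangster[OF assms(2), of Jbar], of "transpose V"]
  by (simp add: reduce_eq_lift sym_mat_nth)

text \<open>
  Take \<open>W\<close> equal to a constant \<open>t\<close> on \<open>J\<close> and to \<open>- t (n + 1)\<close> at \<open>(0, 0)\<close>.  On a consistent \<open>y\<close> its gangster part
  has the form \<open>t \<Sum>\<^sub>q ((\<Sum>\<^sub>p y\<^sub>p\<^sub>q)\<^sup>2 - \<Sum>\<^sub>p y\<^sub>p\<^sub>q\<^sup>2) - t (n + 1) y\<^sub>0\<^sup>2\<close>, and \<open>\<Sum>\<^sub>p y\<^sub>p\<^sub>q = y\<^sub>0\<close> turns this into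
  \<open>- t \<parallel>y\<parallel>\<^sup>2\<close>.  So any \<open>t\<close> above a norm bound for \<open>LG\<close> is strictly feasible.
\<close>

lemma dual_slater:
  assumes G: "sym_mat G"
  shows "\<exists>W. sym_mat W \<and> reduce V (gangster Jbar W) \<prec>\<^sub>L reduce V (LG G)"
proof -
  obtain c where c: "\<And>y :: real^(('k \<times> 'n) option). \<bar>y \<bullet> (LG G *v y)\<bar> \<le> c * (y \<bullet> y)"
    using quadform_norm_bound[of "LG G :: real^(('k \<times> 'n) option)^(('k \<times> 'n) option)"] by blast
  define t where "t = \<bar>c\<bar> + 1"
  define W :: "real^(('k \<times> 'n) option)^(('k \<times> 'n) option)" where
    "W = (\<chi> i j. if i = None \<and> j = None then - t * (real CARD('n) + 1) else t)"
  have symW: "sym_mat W" by (simp add: W_def sym_mat_nth)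
  have quadW: "y \<bullet> (gangster Jbar W *v y) = - t * (y \<bullet> y)" if y: "consistent m y" for y
  proof -
    \<comment> \<open>In the last entry the outer conditional is the condition of equal nodes, the inner one removes equal sets.\<close>
    have g: "gangster Jbar W $ None $ None = - t * (real CARD('n) + 1)"
      "gangster Jbar W $ None $ Some a = 0" "gangster Jbar W $ Some a $ None = 0"
      "gangster Jbar W $ Some (p, q) $ Some (r, s) = (if q = s then t - (if p = r then t else 0) else 0)"
      for a p q r s
      by (auto simp: gangster_def W_def Jbar_def J_def)
    have "y \<bullet> (gangster Jbar W *v y) = - t * (real CARD('n) + 1) * (y $ None)\<^sup>2
        + (\<Sum>p\<in>UNIV. \<Sum>q\<in>UNIV. \<Sum>r\<in>UNIV. \<Sum>s\<in>UNIV.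
           (if q = s then t - (if p = r then t else 0) else 0) * (y $ Some (p, q) * y $ Some (r, s)))"
      unfolding quadform_sum sum_option_prod g by (simp add: power2_eq_square)
    also have "(\<Sum>p\<in>UNIV. \<Sum>q\<in>UNIV. \<Sum>r\<in>UNIV. \<Sum>s\<in>UNIV.
           (if q = s then t - (if p = r then t else 0) else 0) * (y $ Some (p, q) * y $ Some (r, s)))
       = (\<Sum>p\<in>UNIV. \<Sum>q\<in>UNIV. \<Sum>r\<in>UNIV. \<Sum>s\<in>UNIV.
           if q = s then (t - (if p = r then t else 0)) * (y $ Some (p, q) * y $ Some (r, s)) else 0)"
      by (intro sum.cong refl) simp
    also have "\<dots> = (\<Sum>p\<in>UNIV. \<Sum>q\<in>UNIV. \<Sum>r\<in>UNIV. t * (y $ Some (p, q) * y $ Some (r, q)) 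
           - (if p = r then t * (y $ Some (p, q) * y $ Some (r, q)) else 0))"
      by (simp, intro sum.cong refl) (simp add: algebra_simps)
    also have "\<dots> = (\<Sum>p\<in>UNIV. \<Sum>q\<in>UNIV. t * (y $ Some (p, q) * (\<Sum>r\<in>UNIV. y $ Some (r, q))))
         - t * (\<Sum>p\<in>UNIV. \<Sum>q\<in>UNIV. y $ Some (p, q) * y $ Some (p, q))"
      by (simp add: sum_subtractf sum_distrib_left)
    also have "(\<Sum>p\<in>UNIV. \<Sum>q\<in>UNIV. t * (y $ Some (p, q) * (\<Sum>r\<in>UNIV. y $ Some (r, q))))
        = t * (real CARD('n) * (y $ None)\<^sup>2)"
    proof -
      have "(\<Sum>p\<in>UNIV. \<Sum>q\<in>UNIV. t * (y $ Some (p, q) * (\<Sum>r\<in>UNIV. y $ Some (r, q))))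
         = (\<Sum>q\<in>UNIV. t * ((\<Sum>p\<in>UNIV. y $ Some (p, q)) * y $ None))"
        using y unfolding consistent_def
        by (subst sum.swap) (simp add: sum_distrib_left[symmetric] sum_distrib_right[symmetric])
      then show ?thesis using y by (simp add: consistent_def power2_eq_square)
    qed
    also have "(\<Sum>p\<in>UNIV. \<Sum>q\<in>UNIV. y $ Some (p, q) * y $ Some (p, q)) = y \<bullet> y - (y $ None)\<^sup>2"
      by (simp add: inner_vec_def sum_option_prod power2_eq_square)
    finally show ?thesis by (simp add: algebra_simps)
  qed
  have "0 < z \<bullet> ((reduce V (LG G) - reduce V (gangster Jbar W)) *v z)" if z: "z \<noteq> 0" for z
  proof -
    define y where "y = V *v z"
    obtain L where LV: "L ** V = mat 1"
      using Vhat_left_inverse[OF Vk Vn] by metis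
    have "L *v y = z" by (simp add: y_def matrix_vector_mul_assoc LV)
    then have "y \<noteq> 0" using z by auto
    then have "0 < y \<bullet> y" by simp
    then have "c * (y \<bullet> y) < t * (y \<bullet> y)" unfolding t_def by (intro mult_strict_right_mono) auto
    moreover have "consistent m y" unfolding y_def by (rule consistent_Vhat[OF sizes Vk Vn])
    moreover have "z \<bullet> ((reduce V (LG G) - reduce V (gangster Jbar W)) *v z)
        = y \<bullet> (LG G *v y) - y \<bullet> (gangster Jbar W *v y)"
      by (simp add: matrix_vector_mult_diff_rdistrib inner_diff_right quadform_reduce y_def)
    ultimately show ?thesis using c[of y] by (simp add: quadW abs_le_iff)
  qed
  moreover have "sym_mat (reduce V (LG G) - reduce V (gangster Jbar W))"
    by (rule sym_mat_slack[OF G symW])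
  ultimately show ?thesis using symW unfolding loewner_less_def pd_def by blast
qed

lemma inner_gangster_e0: "W \<bullet> gangster Jbar (outer e0 e0) = W $ None $ None"
  for W :: "real^(('k \<times> 'n) option)^(('k \<times> 'n) option)"
  by (simp add: gangster_selfadjoint inner_outer e0_def axis_quadform) (simp add: gangster_def Jbar_def)

lemma dual_final_value:
  assumes G: "sym_mat G" and W: "sym_mat W"
  shows "dual_final G m Vk Vn ((1 / 2) *\<^sub>R W)
         = (if feasible_dual G m Vk Vn W then ereal (obj_dual W) else - \<infinity>)"
proof -
  have "dual_final G m Vk Vn ((1 / 2) *\<^sub>R W) =
    (if psd (reduce V (LG G) - reduce V (gangster Jbar W)) then ereal (obj_dual W) else - \<infinity>)"
    unfolding dual_final_def lagrange_dual_def
  proof (rule conic_lagrange_dual[OF sym_mat_slack[OF G W]])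
    fix Z :: "real^(('k1 \<times> 'n1) option)^(('k1 \<times> 'n1) option)" assume "psd Z"
    then have "transpose Z = Z" by (simp add: psd_def sym_mat_def)
    then show "obj_final G m Vk Vn Z + (1 / 2) *\<^sub>R W \<bullet> (gangster Jbar (outer e0 e0) - gangster Jbar (lift V Z))
       = obj_dual W + 1 / 2 * ((reduce V (LG G) - reduce V (gangster Jbar W)) \<bullet> Z)"
      by (simp add: obj_final_def trace_mult_inner inner_diff_left inner_diff_right inner_gangster_e0
          obj_dual_def reduce_adjoint gangster_selfadjoint[of W Jbar "lift V Z"] algebra_simps)
  qed
  then show ?thesis using W by (simp add: feasible_dual_def loewner_le_def)
qed

text \<open>
  For a primal feasible \<open>Z\<close> twice the dual objective is \<open>W\<^sub>0\<^sub>0 = \<A>' W \<bullet> Z\<close>, hence determined by the slack, as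
  \<open>conic_dual_attained\<close> requires.  Every symmetric multiplier is half of a symmetric matrix, so the supremum of the
  dual function is the maximum of the dual program.
\<close>

lemma dual_final_attained:
  assumes G: "sym_mat G" and Z: "feasible_final m Vk Vn Z" "pd Z"
  shows "\<exists>W. is_arg_max obj_dual (feasible_dual G m Vk Vn) W
         \<and> (SUP U \<in> {U. sym_mat U}. dual_final G m Vk Vn U) = ereal (obj_dual W)"
proof -
  define \<A>' where "\<A>' W = reduce V (gangster Jbar W)" for W
  have feas: "feasible_dual G m Vk Vn W \<longleftrightarrow> sym_mat W \<and> psd (reduce V (LG G) - \<A>' W)" for W
    by (simp add: feasible_dual_def loewner_le_def \<A>'_def)
  obtain W0 where W0: "sym_mat W0" "psd (reduce V (LG G) - \<A>' W0)"
    using dual_slater[OF G] pd_imp_psd unfolding loewner_less_def \<A>'_def by blast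
  have lin: "linear \<A>'"
    using linear_compose[OF linear_gangster linear_lift] by (simp add: o_def \<A>'_def[abs_def] reduce_eq_lift)
  have sub: "subspace {W :: real^(('k \<times> 'n) option)^(('k \<times> 'n) option). sym_mat W}"
    by (auto simp: subspace_def sym_mat_nth)
  have obj: "2 * obj_dual W = \<A>' W \<bullet> Z" for W
  proof -
    have "\<A>' W \<bullet> Z = W \<bullet> gangster Jbar (lift V Z)"
      by (simp add: \<A>'_def reduce_adjoint gangster_selfadjoint)
    then show ?thesis using Z(1) by (simp add: feasible_final_def inner_gangster_e0 obj_dual_def)
  qed
  obtain W where W: "feasible_dual G m Vk Vn W"
    and max: "\<And>W'. feasible_dual G m Vk Vn W' \<Longrightarrow> obj_dual W' \<le> obj_dual W"
    using conic_dual_attained[OF lin sub Z(2), of "\<lambda>W. 2 * obj_dual W" W0 "reduce V (LG G)"] W0 obj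
    unfolding feas mem_Collect_eq by (metis mult_le_cancel_left_pos zero_less_numeral)
  have "(SUP U \<in> {U. sym_mat U}. dual_final G m Vk Vn U) = ereal (obj_dual W)"
  proof (rule antisym)
    show "(SUP U \<in> {U. sym_mat U}. dual_final G m Vk Vn U) \<le> ereal (obj_dual W)"
    proof (rule SUP_least)
      fix U :: "real^(('k \<times> 'n) option)^(('k \<times> 'n) option)" assume "U \<in> {U. sym_mat U}"
      then have "sym_mat (2 *\<^sub>R U)" by (simp add: sym_mat_nth)
      from dual_final_value[OF G this] show "dual_final G m Vk Vn U \<le> ereal (obj_dual W)"
        using max by auto
    qed
    have "sym_mat W" using W by (simp add: feas)
    then show "ereal (obj_dual W) \<le> (SUP U \<in> {U. sym_mat U}. dual_final G m Vk Vn U)"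
      using dual_final_value[OF G, of W] W
      by (intro SUP_upper2[of "(1 / 2) *\<^sub>R W"]) (auto simp: sym_mat_nth)
  qed
  moreover have "is_arg_max obj_dual (feasible_dual G m Vk Vn) W"
    using W max by (auto simp: is_arg_max_def not_less)
  ultimately show ?thesis by blast
qed

end

section \<open>Cuts and diagonal shifts\<close>

text \<open>
  Each edge is counted once for each of its two orientations; this is the factor that the 1/2 in the objective
  compensates.
\<close>

lemma card_ordered_pairs:
  fixes C :: "'a::finite set set"
  assumes "\<And>e. e \<in> C \<Longrightarrow> card e = 2"
  shows "card {(s, t). {s, t} \<in> C} = 2 * card C"
proof -
  have "card (\<Union>e\<in>C. {(s, t). {s, t} = e}) = (\<Sum>e\<in>C. card {(s, t). {s, t} = e})"
    by (rule card_UN_disjoint) auto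
  also have "\<dots> = (\<Sum>e\<in>C. 2)"
  proof (rule sum.cong[OF refl])
    fix e assume "e \<in> C"
    then obtain u v where "e = {u, v}" "u \<noteq> v" using assms by (metis card_2_iff)
    then have "{(s, t). {s, t} = e} = {(u, v), (v, u)}" by (auto simp: doubleton_eq_iff)
    then show "card {(s, t). {s, t} = e} = 2" using \<open>u \<noteq> v\<close> by simp
  qed
  also have "(\<Union>e\<in>C. {(s, t). {s, t} = e}) = {(s, t). {s, t} \<in> C}" by auto
  finally show ?thesis by simp
qed

context partition_reduction
begin

lemma trace_LG:
  "trace (LG G ** Y) = (\<Sum>p\<in>UNIV. \<Sum>q\<in>UNIV. \<Sum>r\<in>UNIV. \<Sum>s\<in>UNIV.
      Bmat $ p $ r * G $ q $ s * Y $ Some (r, s) $ Some (p, q))"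
  for Y :: "real^(('k \<times> 'n) option)^(('k \<times> 'n) option)"
  by (simp add: trace_def matrix_matrix_mult_def sum_option_prod LG_def bordered_def kron_def)

text \<open>
  \<open>Bmat\<close> has zero diagonal, so the term \<open>Bmat \<otimes> Diag d\<close> meets only entries with equal nodes and different sets, where
  the gangster constraint makes \<open>Y\<close> vanish.
\<close>

lemma obj_final_diag_shift:
  assumes F: "feasible_final m Vk Vn Z"
  shows "obj_final (A - Diag d) m Vk Vn Z = obj_final A m Vk Vn Z"
proof -
  have off: "p \<noteq> r \<Longrightarrow> lift V Z $ Some (p, q) $ Some (r, q) = 0" for p r q
    using final_constraints(3)[OF F] by (simp add: gangster_J_zero_iff)
  show ?thesis
    unfolding obj_final_eq trace_LG
    by (intro arg_cong[where f = "\<lambda>x. 1 / 2 * x"] sum.cong refl)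
       (auto simp: Diag_def Bmat_def off)
qed

text \<open>
  Cut the nodes along a bijection with the disjoint union of sets \<open>{..<m\<^sub>i}\<close>.  Without a partition the minimum
  in \<open>min_cut\<close> would range over the empty set.
\<close>

lemma exists_ordered_partition: "\<exists>S :: 'k \<Rightarrow> 'n set. ordered_partition m S"
proof -
  have "card (SIGMA i:UNIV. {..<m $ i}) = card (UNIV :: 'n set)"
    by (simp add: sizes)
  then obtain h :: "'k \<times> nat \<Rightarrow> 'n" where h: "bij_betw h (SIGMA i:UNIV. {..<m $ i}) UNIV"
    by (metis finite_same_card_bij finite_SigmaI finite finite_lessThan)
  have inj: "inj_on h (SIGMA i:UNIV. {..<m $ i})" and im: "h ` (SIGMA i:UNIV. {..<m $ i}) = UNIV"
    using h by (auto simp: bij_betw_def)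
  define S where "S i = h ` ({i} \<times> {..<m $ i})" for i
  have "(\<Union>i. S i) = h ` (SIGMA i:UNIV. {..<m $ i})" by (auto simp: S_def)
  then have "(\<Union>i. S i) = UNIV" using im by simp
  moreover have "S i \<inter> S j = {}" if "i \<noteq> j" for i j
    using that inj by (auto simp: S_def inj_on_def)
  moreover have "card (S i) = m $ i" for i
    unfolding S_def by (subst card_image) (auto intro: inj_on_subset[OF inj])
  ultimately show ?thesis unfolding ordered_partition_def by blast
qed

text \<open>
  The rank-one matrix \<open>y y\<^sup>T\<close> of the indicator vector \<open>y\<close> of the partition lifts from a feasible \<open>Z\<close>, since \<open>y\<close>
  is consistent and no node lies in two sets.
\<close>

lemma partition_feasible:
  assumes E: "simple_graph E" and S: "ordered_partition m S"
  shows "\<exists>Z. feasible_final m Vk Vn Z \<and> obj_final (adjacency E) m Vk Vn Z = real (card (cut_edges E S))"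
proof -
  have "\<exists>p. q \<in> S p" for q using S by (auto simp: ordered_partition_def)
  then obtain f where f: "\<And>q. q \<in> S (f q)" by metis
  have fS: "q \<in> S p \<longleftrightarrow> p = f q" for p q
    using S f unfolding ordered_partition_def by (metis disjoint_iff)
  define y :: "real^(('k \<times> 'n) option)" where
    "y = (\<chi> i. case i of None \<Rightarrow> 1 | Some (p, q) \<Rightarrow> if p = f q then 1 else 0)"
  have yN: "y $ None = 1" and yS: "y $ Some (p, q) = (if p = f q then 1 else 0)" for p q
    by (simp_all add: y_def)
  have "consistent m y"
  proof -
    have "(\<Sum>q\<in>UNIV. if p = f q then 1 else 0) = real (m $ p)" for p
    proof -
      have "(\<Sum>q\<in>UNIV. if p = f q then 1 else 0) = real (card {q. p = f q})"
        by (simp add: sum.If_cases)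
      also have "{q. p = f q} = S p" by (auto simp: fS)
      finally show ?thesis using S by (simp add: ordered_partition_def)
    qed
    then show ?thesis by (simp add: consistent_def yN yS)
  qed
  then have "consistent m (outer y y *v x)" for x
    unfolding outer_mult by (simp add: consistent_iff_normals)
  then obtain Z where Z: "psd Z" "lift V Z = outer y y"
    using lift_eq_of_consistent[OF psd_outer] by metis
  have "feasible_final m Vk Vn Z"
    unfolding feasible_final_def gangster_Jbar_iff gangster_J_zero_iff Z(2)
    by (auto simp: Z(1) outer_def yN yS)
  moreover have "trace (LG (adjacency E) ** outer y y) = 2 * real (card (cut_edges E S))"
  proof -
    have "trace (LG (adjacency E) ** outer y y) = (\<Sum>p\<in>UNIV. \<Sum>q\<in>UNIV. \<Sum>r\<in>UNIV. \<Sum>s\<in>UNIV.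
       if p = f q then (if r = f s then Bmat $ p $ r * adjacency E $ q $ s else 0) else 0)"
      unfolding trace_LG by (intro sum.cong refl) (simp add: outer_def yS)
    also have "\<dots> = (\<Sum>q\<in>UNIV. \<Sum>s\<in>UNIV. Bmat $ f q $ f s * adjacency E $ q $ s)"
    proof -
      have "(\<Sum>r\<in>UNIV. \<Sum>s\<in>UNIV. if r = f s then Bmat $ p $ r * adjacency E $ q $ s else 0)
          = (\<Sum>s\<in>UNIV. Bmat $ p $ f s * adjacency E $ q $ s)" for p :: 'k and q
        by (subst sum.swap) simp
      then have "(\<Sum>p\<in>UNIV. \<Sum>q\<in>UNIV. \<Sum>r\<in>UNIV. \<Sum>s\<in>UNIV.
            if p = f q then (if r = f s then Bmat $ p $ r * adjacency E $ q $ s else 0) else 0)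
          = (\<Sum>p\<in>UNIV. \<Sum>q\<in>UNIV. if p = f q then (\<Sum>s\<in>UNIV. Bmat $ p $ f s * adjacency E $ q $ s) else 0)"
        by (intro sum.cong refl) simp
      also have "\<dots> = (\<Sum>q\<in>UNIV. \<Sum>s\<in>UNIV. Bmat $ f q $ f s * adjacency E $ q $ s)"
        by (subst sum.swap) simp
      finally show ?thesis .
    qed
    also have "\<dots> = (\<Sum>q\<in>UNIV. \<Sum>s\<in>UNIV. if {q, s} \<in> cut_edges E S then 1 else 0)"
    proof (intro sum.cong refl)
      fix q s
      have "{q, s} \<in> cut_edges E S \<longleftrightarrow> {q, s} \<in> E \<and> f q \<noteq> f s \<and> f q \<noteq> last_index \<and> f s \<noteq> last_index"
        unfolding cut_edges_def fS by (auto simp: doubleton_eq_iff) 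
      then show "Bmat $ f q $ f s * adjacency E $ q $ s = (if {q, s} \<in> cut_edges E S then 1 else 0)"
        by (auto simp: Bmat_def adjacency_def)
    qed
    also have "\<dots> = (\<Sum>(q, s)\<in>UNIV. if {q, s} \<in> cut_edges E S then 1 else 0)"
      by (simp add: sum.cartesian_product)
    also have "\<dots> = real (card {(q, s). {q, s} \<in> cut_edges E S})"
      by (simp add: sum.If_cases case_prod_unfold)
    also have "\<dots> = 2 * real (card (cut_edges E S))"
      using E by (subst card_ordered_pairs) (auto simp: cut_edges_def simple_graph_def)
    finally show ?thesis .
  qed
  ultimately show ?thesis by (auto simp: obj_final_eq Z(2))
qed

end

theorem theorem5p1:
  fixes E :: "'n::finite set set"
    and m :: "nat^'k::{finite,linorder}"
    and Vk :: "real^'k1::finite^'k::{finite,linorder}"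
    and Vn :: "real^'n1::finite^'n"
    and d :: "real^'n"
    and G :: "real^'n^'n"
  assumes "simple_graph E" and "E \<noteq> {}"
    and "CARD('k) > 2"
    and "\<forall>i. m $ i > 0" and "(\<Sum>i\<in>UNIV. m $ i) = CARD('n)"
    and "is_V Vk" and "is_V Vn"
    and "G = adjacency E - Diag d"
  shows "
    \<comment> \<open>the facially reduced program is equivalent to the final program\<close>
    {Z. feasible_reduced m Vk Vn Z} = {Z. feasible_final m Vk Vn Z}
    \<and> obj_reduced G m Vk Vn = obj_final G m Vk Vn
    \<comment> \<open>optimal value of the final program\<close>
    \<and> ereal (real (min_cut E m)) \<ge> p_SDP G m
    \<and> (\<exists>Z. is_arg_min (obj_final G m Vk Vn) (feasible_final m Vk Vn) Z
         \<and> p_SDP G m = ereal (obj_final G m Vk Vn Z))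
    \<comment> \<open>the Lagrangian dual program, the multiplier being written as \<open>W / 2\<close>\<close>
    \<and> (\<forall>W. sym_mat W \<longrightarrow> dual_final G m Vk Vn ((1 / 2) *\<^sub>R W)
         = (if feasible_dual G m Vk Vn W then ereal (obj_dual W) else - \<infinity>))
    \<and> (\<exists>W. is_arg_max obj_dual (feasible_dual G m Vk Vn) W
         \<and> (SUP U \<in> {U. sym_mat U}. dual_final G m Vk Vn U) = ereal (obj_dual W))
    \<comment> \<open>Slater's constraint qualification for the primal and for the dual\<close>
    \<and> (\<exists>Z. feasible_final m Vk Vn Z \<and> pd Z)
    \<and> (\<exists>W. sym_mat W
         \<and> reduce (Vhat m Vk Vn) (gangster Jbar W) \<prec>\<^sub>L reduce (Vhat m Vk Vn) (LG G))
    \<comment> \<open>independence of the objective from the vector used to form \<open>G\<close>\<close>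
    \<and> (\<forall>d' Z. feasible_final m Vk Vn Z \<longrightarrow>
         obj_final (adjacency E - Diag d') m Vk Vn Z = obj_final G m Vk Vn Z)"
proof -
  interpret partition_reduction m Vk Vn
    using assms by unfold_locales
  have G: "sym_mat G"
    by (auto simp: assms(8) sym_mat_nth adjacency_def Diag_def insert_commute)
  \<comment> \<open>Sizes at least 1 give \<open>n \<ge> k > 1\<close>, which the factor \<open>n - 1\<close> in the barycenter requires.\<close>
  have "CARD('k) \<le> CARD('n)"
    using sum_mono[of UNIV "\<lambda>_. 1" "\<lambda>i. m $ i"] assms(4,5) by (simp add: Suc_le_eq)
  then have n2: "CARD('n) > 1" using assms(3) by linarith
  obtain Z0 where Z0: "feasible_final m Vk Vn Z0" "pd Z0"
    using primal_slater[OF assms(4) n2] by blast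
  obtain Z where Z: "is_arg_min (obj_final G m Vk Vn) (feasible_final m Vk Vn) Z"
      "p_SDP G m = ereal (obj_final G m Vk Vn Z)"
    using p_SDP_attained[OF Z0(1)] by blast
  have cut: "ereal (real (min_cut E m)) \<ge> p_SDP G m"
  proof -
    have "min_cut E m \<in> (\<lambda>S. card (cut_edges E S)) ` {S. ordered_partition m S}"
      unfolding min_cut_def using exists_ordered_partition by (intro Min_in) auto
    then obtain S where S: "ordered_partition m S" "min_cut E m = card (cut_edges E S)" by auto
    obtain Z' where Z': "feasible_final m Vk Vn Z'"
        "obj_final (adjacency E) m Vk Vn Z' = real (card (cut_edges E S))"
      using partition_feasible[OF assms(1) S(1)] by blast
    then have "obj_final G m Vk Vn Z' = real (min_cut E m)"
      by (simp add: assms(8) S(2) obj_final_diag_shift)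
    moreover have "obj_final G m Vk Vn Z \<le> obj_final G m Vk Vn Z'"
      using Z(1) Z'(1) by (auto simp: is_arg_min_def not_less)
    ultimately show ?thesis by (simp add: Z(2))
  qed
  show ?thesis
  proof (intro conjI)
    show "{Z. feasible_reduced m Vk Vn Z} = {Z. feasible_final m Vk Vn Z}"
      by (simp add: feasible_reduced_iff_final)
    show "obj_reduced G m Vk Vn = obj_final G m Vk Vn"
      by (simp add: fun_eq_iff obj_reduced_def obj_final_def reduce_def)
    show "\<forall>d' Z. feasible_final m Vk Vn Z \<longrightarrow>
         obj_final (adjacency E - Diag d') m Vk Vn Z = obj_final G m Vk Vn Z"
      by (simp add: assms(8) obj_final_diag_shift)
  qed (use cut Z dual_final_value[OF G] dual_final_attained[OF G Z0] Z0 dual_slater[OF G] in blast)+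
qed

end
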